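(* Let $(W_n)_{n=1}^\infty$ be any $\bar{\mathcal P}$-$e$-process satisfying the portfolio regret bound $$\max_{\lambda\in\triangle_d}\sum_{i=1}^n\log(\lambda^\top\mathbf E_i)-\log(W_n)\le r_n\qquad\text{for all }n,$$ for some sublinear sequence $r_n=o(n)$. Let $Q$ be an alternative distribution (with $\ell_Q^\star>0$) for which $$\rho_s(\lambda_Q):=\mathbb E_Q\left|\log(\lambda_Q^\top\mathbf E_1)-\ell_Q^\star\right|^s<\infty$$ for some $s>2$. Then the expectation of the first rejection time $\tau_\alpha:=\inf\{n\in\mathbb N:W_n\ge1/\alpha\}$ satisfies $$\lim_{\alpha\to0^+}\frac{\mathbb E_Q[\tau_\alpha]}{\log(1/\alpha)}=\frac1{\ell_Q^\star}.$$
   Context: Fix $d\in\mathbb N$ and let $\triangle_d=\{\lambda\in[0,1]^{d+1}:\sum_{j=0}^d\lambda^{(j)}=1\}$. Work on a measurable space with a discrete-time filtration $(\mathcal F_n)_{n\ge0}$, $\mathcal F_0$ trivial (for concreteness, one can think of $\mathcal F_n$ as the sigma-algebra generated by the random objects observed up to time $n$). Let $(\mathbf E_n)_{n=1}^\infty$, $\mathbf E_n=(E_n^{(0)},\dots,E_n^{(d)})$, be random vectors with values in $[0,\infty)^{d+1}$, with possibly dependent coordinates. Under every distribution considered, $(\mathbf E_n)$ is i.i.d. $\bar{\mathcal P}$ is the set of all distributions $P$ with $\mathbb E_P[E_1^{(j)}]\le1$ for each $j\in\{0,1,\dots,d\}$. An alternative distribution is a distribution $Q$ under which $(\mathbf E_n)$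 is i.i.d. A test $P$-supermartingale is a nonnegative process $(M_n)$ adapted to $(\mathcal F_n)$ with $\mathbb E_P[M_n\mid\mathcal F_{n-1}]\le M_{n-1}$ $P$-a.s. for $n\ge2$ and $\mathbb E_P[M_1]\le1$. A $\bar{\mathcal P}$-$e$-process is a nonnegative adapted process $(W_n)$ such that for each $P\in\bar{\mathcal P}$ there is a test $P$-supermartingale $(M_n^{(P)})$ with $W_n\le M_n^{(P)}$ for all $n$, $P$-a.s. For an alternative $Q$: $\lambda_Q\in\arg\max_{\lambda\in\triangle_d}\mathbb E_Q[\log(\lambda^\top\mathbf E_1)]$ and $\ell_Q^\star=\mathbb E_Q[\log(\lambda_Q^\top\mathbf E_1)]=\max_{\lambda\in\triangle_d}\mathbb E_Q[\log(\lambda^\top\mathbf E_1)]$. Convention: $\inf\emptyset=\infty$. The regret bound $(r_n)$ is deterministic and holds for every outcome.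
   Formalization: Added: mixing the optimal portfolio with cash (constant 1) does not raise its growth rate under Q (automatic if some coordinate is 1); otherwise a universal portfolio including cash refutes the claim. The filtration is that of the observations, and E_n is independent of F_{n-1}. *)

theory Defs
  imports "HOL-Probability.Probability"
begin

text \<open>
  The index set \<open>{0, ..., d}\<close> of the coordinates is an arbitrary finite type \<open>'d\<close>, so
  \<open>d + 1 = CARD('d)\<close>. At each time \<open>n \<ge> 1\<close> one observes a pair: the vector
  \<open>\<^bold>E\<^sub>n \<in> [0,\<infinity>)\<^bsup>d+1\<^esup>\<close> and, in an arbitrary measurable space \<open>S\<close>, whatever else is observed
  at time \<open>n\<close> (take \<open>S\<close> a one-point space to observe only the vectors). The measurable space is
  the canonical space of all observation sequences, so that ``all distributions'' really are
  available on it.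
\<close>

type_synonym ('d, 'b) path = "nat \<Rightarrow> (real^'d) \<times> 'b"

definition obs :: "'b measure \<Rightarrow> ((real^'d::finite) \<times> 'b) measure" where
  "obs S = restrict_space borel {x. \<forall>j. 0 \<le> x $ j} \<Otimes>\<^sub>M S"

definition path_space :: "'b measure \<Rightarrow> ('d::finite, 'b) path measure" where
  "path_space S = PiM {1..} (\<lambda>_. obs S)"

definition evec :: "nat \<Rightarrow> ('d::finite, 'b) path \<Rightarrow> real^'d" where
  "evec n \<omega> = fst (\<omega> n)"

text \<open>The sigma-algebra generated by the observations at times \<open>1, ..., n\<close>; trivial for \<open>n = 0\<close>.\<close>

definition obs_filtration :: "'b measure \<Rightarrow> nat \<Rightarrow> ('d::finite, 'b) path measure" where
  "obs_filtration S n = vimage_algebra (space (path_space S)) (\<lambda>\<omega>. restrict \<omega> {1..n}) (PiM {1..n} (\<lambda>_. obs S))"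

text \<open>
  Distributions under which \<open>(\<^bold>E\<^sub>n)\<close> is i.i.d.; as usual for a process adapted to a given
  filtration, \<open>\<^bold>E\<^sub>n\<close> is also independent of the past \<open>\<F>\<^bsub>n-1\<^esub>\<close>. The latter is automatic when only the
  vectors \<open>\<^bold>E\<^sub>n\<close> are observed.
\<close>

definition iid_dist :: "'b measure \<Rightarrow> ('d::finite, 'b) path measure \<Rightarrow> bool" where
  "iid_dist S P \<longleftrightarrow>
     prob_space P \<and> sets P = sets (path_space S) \<and>
     prob_space.indep_vars P (\<lambda>_. borel) evec {1..} \<and>
     (\<forall>n\<ge>1. distr P borel (evec n) = distr P borel (evec 1)) \<and>
     (\<forall>n\<ge>1. prob_space.indep_set P
        (sets (vimage_algebra (space (path_space S)) (evec n) borel)) (sets (obs_filtration S (n - 1))))"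

definition null_dists :: "'b measure \<Rightarrow> ('d::finite, 'b) path measure set" where
  "null_dists S = {P. iid_dist S P \<and> (\<forall>j. (\<integral>\<^sup>+ \<omega>. ennreal (evec 1 \<omega> $ j) \<partial>P) \<le> 1)}"

definition nonneg_adapted :: "'b measure \<Rightarrow> (nat \<Rightarrow> ('d::finite, 'b) path \<Rightarrow> real) \<Rightarrow> bool" where
  "nonneg_adapted S M \<longleftrightarrow>
     (\<forall>n\<ge>1. M n \<in> borel_measurable (obs_filtration S n) \<and> (\<forall>\<omega>\<in>space (path_space S). 0 \<le> M n \<omega>))"

definition test_supermartingale ::
  "'b measure \<Rightarrow> ('d::finite, 'b) path measure \<Rightarrow> (nat \<Rightarrow> ('d, 'b) path \<Rightarrow> real) \<Rightarrow> bool" where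
  "test_supermartingale S P M \<longleftrightarrow>
     nonneg_adapted S M \<and>
     (\<integral>\<^sup>+ \<omega>. ennreal (M 1 \<omega>) \<partial>P) \<le> 1 \<and>
     (\<forall>n\<ge>2. AE \<omega> in P. nn_cond_exp P (obs_filtration S (n - 1)) (\<lambda>\<omega>. ennreal (M n \<omega>)) \<omega> \<le> ennreal (M (n - 1) \<omega>))"

definition e_process :: "'b measure \<Rightarrow> (nat \<Rightarrow> ('d::finite, 'b) path \<Rightarrow> real) \<Rightarrow> bool" where
  "e_process S W \<longleftrightarrow>
     nonneg_adapted S W \<and>
     (\<forall>P\<in>null_dists S. \<exists>M. test_supermartingale S P M \<and> (AE \<omega> in P. \<forall>n\<ge>1. W n \<omega> \<le> M n \<omega>))"

definition weight_simplex :: "(real^'d::finite) set" where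
  "weight_simplex = {lam. (\<forall>j. 0 \<le> lam $ j \<and> lam $ j \<le> 1) \<and> (\<Sum>j\<in>UNIV. lam $ j) = 1}"

text \<open>The logarithm on \<open>[0,\<infinity>)\<close> with \<open>log 0 = -\<infinity>\<close> (the library has \<open>ln 0 = 0\<close>).\<close>

definition elog :: "real \<Rightarrow> ereal" where
  "elog x = (if x = 0 then - \<infinity> else ereal (ln x))"

text \<open>
  \<open>E\<^sub>Q[log X]\<close> for \<open>X \<ge> 0\<close>, as positive part minus negative part (\<open>e2ennreal\<close> truncates at 0).
  If both are infinite, the value is \<open>\<infinity>\<close>; this cannot occur at any point of the simplex when the
  maximum over the simplex is finite.
\<close>

definition expected_log :: "'a measure \<Rightarrow> ('a \<Rightarrow> real) \<Rightarrow> ereal" where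
  "expected_log Q X =
     enn2ereal (\<integral>\<^sup>+ \<omega>. e2ennreal (elog (X \<omega>)) \<partial>Q) - enn2ereal (\<integral>\<^sup>+ \<omega>. e2ennreal (- elog (X \<omega>)) \<partial>Q)"

definition log_optimal :: "('d::finite, 'b) path measure \<Rightarrow> real^'d \<Rightarrow> bool" where
  "log_optimal Q lam \<longleftrightarrow>
     is_arg_max (\<lambda>mu. expected_log Q (\<lambda>\<omega>. mu \<bullet> evec 1 \<omega>)) (\<lambda>mu. mu \<in> weight_simplex) lam"

text \<open>\<open>E\<^sub>Q |log X - l|\<^sup>s\<close>, with \<open>|log 0 - l|\<^sup>s = \<infinity>\<close>.\<close>

definition log_abs_moment :: "'a measure \<Rightarrow> real \<Rightarrow> ('a \<Rightarrow> real) \<Rightarrow> real \<Rightarrow> ennreal" where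
  "log_abs_moment Q s X l =
     (\<integral>\<^sup>+ \<omega>. (if X \<omega> = 0 then \<infinity> else ennreal (\<bar>ln (X \<omega>) - l\<bar> powr s)) \<partial>Q)"

text \<open>The regret bound, for every outcome, written as \<open>max ... \<le> log W\<^sub>n + r\<^sub>n\<close> because both the
  maximum and \<open>log W\<^sub>n\<close> may be \<open>-\<infinity>\<close>.\<close>

definition portfolio_regret_bound ::
  "'b measure \<Rightarrow> (nat \<Rightarrow> ('d::finite, 'b) path \<Rightarrow> real) \<Rightarrow> (nat \<Rightarrow> real) \<Rightarrow> bool" where
  "portfolio_regret_bound S W r \<longleftrightarrow>
     (\<forall>\<omega>\<in>space (path_space S). \<forall>n\<ge>1.
        (SUP lam\<in>weight_simplex. \<Sum>i=1..n. elog (lam \<bullet> evec i \<omega>)) \<le> elog (W n \<omega>) + ereal (r n))"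

text \<open>The infimum is taken in \<open>enat\<close>, so that it is \<open>\<infinity>\<close> for the empty set.\<close>

definition rejection_time :: "(nat \<Rightarrow> 'a \<Rightarrow> real) \<Rightarrow> real \<Rightarrow> 'a \<Rightarrow> enat" where
  "rejection_time W \<alpha> \<omega> = Inf {enat n | n. n \<ge> 1 \<and> W n \<omega> \<ge> 1 / \<alpha>}"

text \<open>
  The portfolio \<open>lam\<close> cannot be improved by keeping a fraction \<open>\<kappa>\<close> of the wealth as cash (an asset
  with constant return 1). If it can, a universal portfolio over cash and the coordinates is an
  e-process with logarithmic regret whose growth rate exceeds the maximum over the simplex, e.g. for
  \<open>d = 0\<close> and \<open>Q(E = 4) = Q(E = 1/2) = 1/2\<close>.
\<close>

definition cash_superfluous :: "('d::finite, 'b) path measure \<Rightarrow> real^'d \<Rightarrow> bool" where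
  "cash_superfluous Q lam \<longleftrightarrow>
     (\<forall>\<kappa>\<in>{0..1}. expected_log Q (\<lambda>\<omega>. \<kappa> + (1 - \<kappa>) * (lam \<bullet> evec 1 \<omega>))
                  \<le> expected_log Q (\<lambda>\<omega>. lam \<bullet> evec 1 \<omega>))"

text \<open>In particular this holds if one of the coordinates is itself cash.\<close>

lemma expected_log_cong_AE:
  assumes "AE \<omega> in Q. X \<omega> = Y \<omega>"
  shows "expected_log Q X = expected_log Q Y"
proof -
  have "(\<integral>\<^sup>+ \<omega>. e2ennreal (elog (X \<omega>)) \<partial>Q) = (\<integral>\<^sup>+ \<omega>. e2ennreal (elog (Y \<omega>)) \<partial>Q)"
    "(\<integral>\<^sup>+ \<omega>. e2ennreal (- elog (X \<omega>)) \<partial>Q) = (\<integral>\<^sup>+ \<omega>. e2ennreal (- elog (Y \<omega>)) \<partial>Q)"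
    using assms by (auto intro!: nn_integral_cong_AE)
  then show ?thesis
    by (simp add: expected_log_def)
qed

lemma cash_superfluous_if_cash_coordinate:
  fixes Q :: "('d::finite, 'b) path measure"
  assumes cash: "AE \<omega> in Q. evec 1 \<omega> $ j0 = 1" and opt: "log_optimal Q lam"
  shows "cash_superfluous Q lam"
  unfolding cash_superfluous_def
proof
  fix \<kappa> :: real
  assume \<kappa>: "\<kappa> \<in> {0..1}"
  define mu where "mu = \<kappa> *\<^sub>R axis j0 1 + (1 - \<kappa>) *\<^sub>R lam"
  have lam: "lam \<in> weight_simplex"
    using opt by (auto simp: log_optimal_def is_arg_max_def)
  have "(\<Sum>j\<in>UNIV. mu $ j) = 1"
    using lam by (simp add: mu_def weight_simplex_def axis_def sum.distrib sum_distrib_left[symmetric])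
  moreover have "0 \<le> mu $ j \<and> mu $ j \<le> 1" for j
  proof
    have l: "0 \<le> lam $ j" "lam $ j \<le> 1"
      using lam by (auto simp: weight_simplex_def)
    have a: "0 \<le> axis j0 (1::real) $ j" "axis j0 (1::real) $ j \<le> 1"
      by (auto simp: axis_def)
    show "0 \<le> mu $ j"
      using l a \<kappa> by (simp add: mu_def)
    have "mu $ j \<le> \<kappa> * 1 + (1 - \<kappa>) * 1"
      unfolding mu_def using l a \<kappa>
      by (simp only: vector_add_component vector_scaleR_component real_scaleR_def)
         (intro add_mono mult_left_mono; simp)
    then show "mu $ j \<le> 1"
      by simp
  qed
  ultimately have mu: "mu \<in> weight_simplex"
    by (auto simp: weight_simplex_def)
  have "AE \<omega> in Q. \<kappa> + (1 - \<kappa>) * (lam \<bullet> evec 1 \<omega>) = mu \<bullet> evec 1 \<omega>"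
    using cash by eventually_elim (simp add: mu_def inner_add_left inner_axis')
  then have "expected_log Q (\<lambda>\<omega>. \<kappa> + (1 - \<kappa>) * (lam \<bullet> evec 1 \<omega>)) = expected_log Q (\<lambda>\<omega>. mu \<bullet> evec 1 \<omega>)"
    by (rule expected_log_cong_AE)
  also have "\<dots> \<le> expected_log Q (\<lambda>\<omega>. lam \<bullet> evec 1 \<omega>)"
    using opt mu by (auto simp: log_optimal_def is_arg_max_linorder)
  finally show "expected_log Q (\<lambda>\<omega>. \<kappa> + (1 - \<kappa>) * (lam \<bullet> evec 1 \<omega>))
                  \<le> expected_log Q (\<lambda>\<omega>. lam \<bullet> evec 1 \<omega>)" .
qed

end

theory Submission
  imports Defs "HOL-Real_Asymp.Real_Asymp"
begin

text \<open>
  Let \<open>S\<^sub>n = (\<Sum>i\<le>n. ln (\<lambda> \<bullet> E\<^sub>i))\<close> be the log-wealth of the log-optimal portfolio \<open>\<lambda>\<close>, a random walk with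
  drift \<open>l\<close> under \<open>Q\<close>, let \<open>b = ln (1/\<alpha>)\<close>, and let \<open>\<tau>\<close> be the rejection time. Since
  \<open>E \<tau> = (\<Sum>t. Q (\<tau> > t))\<close> and \<open>E\<^sub>t\<^sub>+\<^sub>1\<close> is independent of the event \<open>\<tau> > t\<close>, Wald's identity
  \<open>E S\<^bsub>min \<tau> N\<^esub> = l * E (min \<tau> N)\<close> is a finite sum of products (\<open>wald_identity_truncated\<close>). The theorem
  follows from an upper and a lower bound for \<open>E \<tau>\<close> that are both \<open>b / l\<close> to first order.

  Upper bound (\<open>expected_duration_upper_bound\<close>). The regret bound gives \<open>ln W\<^sub>n \<ge> S\<^sub>n - r\<^sub>n\<close>, and
  \<open>r\<^sub>n \<le> C + \<epsilon> n\<close> by sublinearity. So before rejection the walk with increments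
  \<open>min (ln (\<lambda> \<bullet> E\<^sub>i)) c - \<epsilon>\<close> stays below \<open>b + C\<close>, and truncation at \<open>c\<close> makes its last step overshoot this
  level by at most \<open>c\<close>. By Wald's identity, \<open>E \<tau> \<le> (b + C + c) / v\<close> where \<open>v\<close> is the mean increment;
  \<open>v\<close> is as close to \<open>l\<close> as desired for large \<open>c\<close> and small \<open>\<epsilon>\<close>.

  Lower bound (\<open>expected_duration_lower_bound\<close>). The wealth \<open>\<lambda> \<bullet> E\<close> is a numeraire: the first-order
  conditions for log-optimality say that \<open>E\<^sub>Q (E\<^sup>j / \<lambda> \<bullet> E) \<le> 1\<close> for all \<open>j\<close>, and superfluous cash means
  \<open>E\<^sub>Q (1 / \<lambda> \<bullet> E) \<le> 1\<close> (\<open>log_optimal_ratio_le_one\<close>). Hence the density \<open>1 / \<lambda> \<bullet> E\<close> turns the law of \<open>E\<close>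
  into a sub-probability under which all coordinates have mean at most 1, and they still do after the
  missing mass has been placed at the vector \<open>0\<close>. Up to any finite horizon \<open>N\<close> this yields a null
  distribution \<open>P\<close> that dominates the measure with density \<open>exp (- S\<^sub>n)\<close> with respect to \<open>Q\<close>
  on the events of time \<open>n \<le> N\<close> (\<open>ex_null_dist_dominating\<close>). As \<open>W\<close> is bounded by a test
  \<open>P\<close>-supermartingale, \<open>E\<^sub>Q (W\<^sub>\<tau> * exp (- S\<^sub>\<tau>); \<tau> \<le> N) \<le> 1\<close>. Now \<open>W\<^sub>\<tau> \<ge> exp b\<close>, and \<open>x + 1 \<le> exp x\<close>
  removes the exponential, with \<open>E\<^sub>Q (exp (- S\<^sub>N)) \<le> 1\<close> taking care of the paths with \<open>\<tau> > N\<close>: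
  \<open>b * Q (\<tau> \<le> N) - E S\<^bsub>min \<tau> N\<^esub> \<le> 1\<close>. Wald's identity and \<open>N \<rightarrow> \<infinity>\<close> give
  \<open>b \<le> l * E \<tau> + 1\<close>.
\<close>

section \<open>Expected logarithms and first-order optimality\<close>

text \<open>
  A finite expected logarithm cannot come from the convention for \<open>\<infinity> - \<infinity>\<close>, so both parts are finite
  and it is an ordinary integral. In particular \<open>X\<close> vanishes on a null set only, which is what allows
  passing from \<open>elog\<close> to \<open>ln\<close>.
\<close>

lemma expected_log_eq_ereal:
  fixes X :: "'a \<Rightarrow> real"
  assumes X[measurable]: "X \<in> borel_measurable Q" and nonneg: "\<And>\<omega>. \<omega> \<in> space Q \<Longrightarrow> 0 \<le> X \<omega>"
    and eq: "expected_log Q X = ereal v"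
  shows "AE \<omega> in Q. 0 < X \<omega>" "integrable Q (\<lambda>\<omega>. ln (X \<omega>))" "(\<integral>\<omega>. ln (X \<omega>) \<partial>Q) = v"
proof -
  have [measurable]: "(\<lambda>\<omega>. elog (X \<omega>)) \<in> borel_measurable Q"
    unfolding elog_def by measurable
  define p where "p = (\<integral>\<^sup>+ \<omega>. e2ennreal (elog (X \<omega>)) \<partial>Q)"
  define q where "q = (\<integral>\<^sup>+ \<omega>. e2ennreal (- elog (X \<omega>)) \<partial>Q)"
  have pq: "enn2ereal p - enn2ereal q = ereal v"
    using eq by (simp add: expected_log_def p_def q_def)
  have fin: "p \<noteq> \<infinity>" "q \<noteq> \<infinity>"
    using pq by (cases p; cases q; auto)+
  have "AE \<omega> in Q. e2ennreal (- elog (X \<omega>)) \<noteq> \<infinity>"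
    using fin(2) unfolding q_def by (intro nn_integral_PInf_AE) auto
  then show pos: "AE \<omega> in Q. 0 < X \<omega>"
    using AE_space
  proof eventually_elim
    case (elim \<omega>)
    then show ?case using nonneg[of \<omega>] by (cases "X \<omega> = 0") (auto simp: elog_def)
  qed
  have p: "p = (\<integral>\<^sup>+ \<omega>. ennreal (ln (X \<omega>)) \<partial>Q)"
    unfolding p_def using pos by (intro nn_integral_cong_AE, eventually_elim) (simp add: elog_def)
  have q: "q = (\<integral>\<^sup>+ \<omega>. ennreal (- ln (X \<omega>)) \<partial>Q)"
    unfolding q_def using pos by (intro nn_integral_cong_AE, eventually_elim) (simp add: elog_def)
  show int: "integrable Q (\<lambda>\<omega>. ln (X \<omega>))"
    using fin unfolding p q by (simp add: real_integrable_def)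
  show "(\<integral>\<omega>. ln (X \<omega>) \<partial>Q) = v"
    using fin pq unfolding real_lebesgue_integral_def[OF int] p[symmetric] q[symmetric]
    by (cases p; cases q; auto)
qed

text \<open>
  The integrable minorant makes the negative part finite; the bound on the difference then makes the
  positive part finite as well.
\<close>

lemma expected_log_le_ereal:
  fixes X :: "'a \<Rightarrow> real"
  assumes X[measurable]: "X \<in> borel_measurable Q" and pos: "AE \<omega> in Q. 0 < X \<omega>"
    and lower: "integrable Q L" "AE \<omega> in Q. L \<omega> \<le> ln (X \<omega>)"
    and le: "expected_log Q X \<le> ereal v"
  shows "integrable Q (\<lambda>\<omega>. ln (X \<omega>))" "(\<integral>\<omega>. ln (X \<omega>) \<partial>Q) \<le> v"
proof -
  define p where "p = (\<integral>\<^sup>+ \<omega>. ennreal (ln (X \<omega>)) \<partial>Q)"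
  define q where "q = (\<integral>\<^sup>+ \<omega>. ennreal (- ln (X \<omega>)) \<partial>Q)"
  have p: "(\<integral>\<^sup>+ \<omega>. e2ennreal (elog (X \<omega>)) \<partial>Q) = p"
    unfolding p_def using pos by (intro nn_integral_cong_AE, eventually_elim) (simp add: elog_def)
  have q: "(\<integral>\<^sup>+ \<omega>. e2ennreal (- elog (X \<omega>)) \<partial>Q) = q"
    unfolding q_def using pos by (intro nn_integral_cong_AE, eventually_elim) (simp add: elog_def)
  have pq: "enn2ereal p - enn2ereal q \<le> ereal v"
    using le by (simp add: expected_log_def p q)
  have "q \<le> (\<integral>\<^sup>+ \<omega>. ennreal (- L \<omega>) \<partial>Q)"
    unfolding q_def using lower(2) by (intro nn_integral_mono_AE, eventually_elim) (rule ennreal_leI, simp)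
  also have "\<dots> < \<infinity>"
    using lower(1) by (simp add: real_integrable_def less_top)
  finally have fin: "p \<noteq> \<infinity>" "q \<noteq> \<infinity>"
    using pq by (cases p; cases q; auto)+
  show int: "integrable Q (\<lambda>\<omega>. ln (X \<omega>))"
    using fin unfolding p_def q_def by (simp add: real_integrable_def)
  show "(\<integral>\<omega>. ln (X \<omega>) \<partial>Q) \<le> v"
    using fin pq unfolding real_lebesgue_integral_def[OF int] p_def[symmetric] q_def[symmetric]
    by (cases p; cases q; auto)
qed

text \<open>
  The first-order condition at an optimum \<open>Y\<close>: the function \<open>k \<mapsto> E (ln (k V + (1 - k) Y))\<close> has the right
  derivative \<open>E (V / Y) - 1\<close> at \<open>0\<close>, which cannot be positive. Differentiation under the integral is replaced
  by Fatou's lemma.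
\<close>

lemma (in prob_space) log_optimal_ratio_le_one:
  fixes Y V :: "'a \<Rightarrow> real"
  assumes [measurable]: "Y \<in> borel_measurable M" "V \<in> borel_measurable M"
    and nonneg: "\<And>\<omega>. \<omega> \<in> space M \<Longrightarrow> 0 \<le> Y \<omega>" "\<And>\<omega>. \<omega> \<in> space M \<Longrightarrow> 0 \<le> V \<omega>"
    and Y: "expected_log M Y = ereal v"
    and opt: "\<And>k. 0 < k \<Longrightarrow> k < 1 \<Longrightarrow> expected_log M (\<lambda>\<omega>. k * V \<omega> + (1 - k) * Y \<omega>) \<le> ereal v"
  shows "(\<integral>\<^sup>+ \<omega>. ennreal (V \<omega> / Y \<omega>) \<partial>M) \<le> 1"
proof -
  note Y_pos = expected_log_eq_ereal(1)[OF _ nonneg(1) Y, simplified]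
  note Y_int = expected_log_eq_ereal(2)[OF _ nonneg(1) Y, simplified]
  note Y_eq = expected_log_eq_ereal(3)[OF _ nonneg(1) Y, simplified]
  \<comment> \<open>Subtracting \<open>ln (1 - k)\<close> makes the difference quotients nonnegative, as Fatou's lemma requires;
  it shifts their limit from \<open>V / Y - 1\<close> to \<open>V / Y\<close> and the bound for their integrals from \<open>0\<close> to 1.\<close>
  define f where "f k \<omega> = (ln (k * V \<omega> + (1 - k) * Y \<omega>) - ln (Y \<omega>) - ln (1 - k)) / k" for k \<omega>
  have [measurable]: "f k \<in> borel_measurable M" for k
    unfolding f_def by measurable
  have f_bound: "(\<integral>\<^sup>+ \<omega>. ennreal (f k \<omega>) \<partial>M) \<le> ennreal (- ln (1 - k) / k)" if k: "0 < k" "k < 1" for k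
  proof -
    let ?Z = "\<lambda>\<omega>. k * V \<omega> + (1 - k) * Y \<omega>"
    have Z_ge: "AE \<omega> in M. (1 - k) * Y \<omega> \<le> ?Z \<omega>"
      using nonneg k by (intro AE_I2) auto
    have Z_pos: "AE \<omega> in M. 0 < ?Z \<omega>"
      using Y_pos Z_ge
    proof eventually_elim
      case (elim \<omega>)
      have "0 < (1 - k) * Y \<omega>" using elim k by simp
      then show ?case using elim by linarith
    qed
    have L: "AE \<omega> in M. ln (1 - k) + ln (Y \<omega>) \<le> ln (?Z \<omega>)"
      using Y_pos Z_ge
    proof eventually_elim
      case (elim \<omega>)
      have "0 < (1 - k) * Y \<omega>" using elim k by simp
      then have "ln ((1 - k) * Y \<omega>) \<le> ln (?Z \<omega>)" using elim by simp
      then show ?case using elim k by (simp add: ln_mult)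
    qed
    have int_L: "integrable M (\<lambda>\<omega>. ln (1 - k) + ln (Y \<omega>))"
      using Y_int by simp
    have Z: "integrable M (\<lambda>\<omega>. ln (?Z \<omega>))" "(\<integral>\<omega>. ln (?Z \<omega>) \<partial>M) \<le> v"
      using expected_log_le_ereal[OF _ Z_pos int_L L opt[OF k]] by auto
    have "(\<integral>\<^sup>+ \<omega>. ennreal (f k \<omega>) \<partial>M) = ennreal (\<integral>\<omega>. f k \<omega> \<partial>M)"
      using Z(1) Y_int L k unfolding f_def
      by (intro nn_integral_eq_integral) auto
    also have "(\<integral>\<omega>. f k \<omega> \<partial>M) = ((\<integral>\<omega>. ln (?Z \<omega>) \<partial>M) - v - ln (1 - k)) / k"
      unfolding f_def using Z(1) Y_int Y_eq prob_space by simp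
    also have "\<dots> \<le> - ln (1 - k) / k"
      using Z(2) k by (intro divide_right_mono) auto
    finally show ?thesis by (simp add: ennreal_leI)
  qed
  \<comment> \<open>Any sequence in \<open>(0, 1)\<close> that tends to \<open>0\<close> would do.\<close>
  define k where "k n = 1 / real (n + 2)" for n :: nat
  have k: "0 < k n" "k n < 1" for n
    by (auto simp: k_def)
  have lim: "((\<lambda>x. (ln (x * c + (1 - x) * y) - ln y - ln (1 - x)) / x) \<longlongrightarrow> c / y) (at_right 0)"
    if "0 < y" for c y :: real
  proof -
    have "((\<lambda>x. (ln (x * c + (1 - x) * y) - ln y - ln (1 - x))) has_real_derivative c / y) (at 0)"
      using that by (auto intro!: derivative_eq_intros simp: field_simps)
    then have "((\<lambda>x. (ln (x * c + (1 - x) * y) - ln y - ln (1 - x)) / x) \<longlongrightarrow> c / y) (at 0)"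
      using that by (simp add: DERIV_def)
    then show ?thesis by (rule filterlim_mono) (auto simp: at_le)
  qed
  have k_lim: "filterlim k (at_right 0) sequentially"
    unfolding k_def by real_asymp
  have ptw: "AE \<omega> in M. (\<lambda>n. ennreal (f (k n) \<omega>)) \<longlonglongrightarrow> ennreal (V \<omega> / Y \<omega>)"
    using Y_pos
  proof eventually_elim
    case (elim \<omega>)
    show ?case unfolding f_def
      by (intro tendsto_ennrealI filterlim_compose[OF lim[OF elim] k_lim])
  qed
  have "(\<integral>\<^sup>+ \<omega>. ennreal (V \<omega> / Y \<omega>) \<partial>M) = (\<integral>\<^sup>+ \<omega>. liminf (\<lambda>n. ennreal (f (k n) \<omega>)) \<partial>M)"
  proof (rule nn_integral_cong_AE)
    show "AE \<omega> in M. ennreal (V \<omega> / Y \<omega>) = liminf (\<lambda>n. ennreal (f (k n) \<omega>))"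
      using ptw by eventually_elim (rule lim_imp_Liminf[symmetric], auto)
  qed
  also have "\<dots> \<le> liminf (\<lambda>n. \<integral>\<^sup>+ \<omega>. ennreal (f (k n) \<omega>) \<partial>M)"
    by (rule nn_integral_liminf) measurable
  also have "\<dots> \<le> liminf (\<lambda>n. ennreal (- ln (1 - k n) / k n))"
    by (intro Liminf_mono always_eventually allI f_bound k)
  also have "\<dots> = 1"
  proof (rule lim_imp_Liminf)
    have "(\<lambda>n. - ln (1 - k n) / k n) \<longlonglongrightarrow> 1"
      unfolding k_def by real_asymp
    then show "(\<lambda>n. ennreal (- ln (1 - k n) / k n)) \<longlonglongrightarrow> 1"
      using tendsto_ennrealI by fastforce
  qed simp
  finally show ?thesis .
qed

section \<open>The filtration of the observations\<close>

lemma measurable_fst_obs[measurable]: "fst \<in> borel_measurable (obs S)"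
  unfolding obs_def
  by (rule measurable_compose[OF measurable_fst]) (rule measurable_restrict_space1, simp)

lemma space_obs_filtration[simp]: "space (obs_filtration S n) = space (path_space S)"
  by (simp add: obs_filtration_def)

lemma measurable_restrict_path[measurable]:
  "(\<lambda>\<omega>. restrict \<omega> {1..n}) \<in> measurable (path_space S) (PiM {1..n} (\<lambda>_. obs S))"
  unfolding path_space_def by (rule measurable_restrict_subset) auto

lemma measurable_restrict_filtration:
  "(\<lambda>\<omega>. restrict \<omega> {1..n}) \<in> measurable (obs_filtration S n) (PiM {1..n} (\<lambda>_. obs S))"
  unfolding obs_filtration_def
  by (rule measurable_vimage_algebra1) (use measurable_space[OF measurable_restrict_path] in auto)

lemma sets_obs_filtration:
  "sets (obs_filtration S n) =
     {(\<lambda>\<omega>. restrict \<omega> {1..n}) -` B \<inter> space (path_space S) | B. B \<in> sets (PiM {1..n} (\<lambda>_. obs S))}"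
  unfolding obs_filtration_def
  by (rule sets_vimage_algebra2) (use measurable_space[OF measurable_restrict_path] in auto)

lemma subalgebra_obs_filtration: "subalgebra (path_space S) (obs_filtration S n)"
  unfolding subalgebra_def obs_filtration_def
  using sets_image_in_sets[OF refl measurable_restrict_path] by auto

lemma subalgebra_obs_filtration_mono:
  assumes "k \<le> n"
  shows "subalgebra (obs_filtration S n) (obs_filtration S k :: ('d::finite, 'b) path measure)"
proof -
  have "(\<lambda>\<omega>. restrict (restrict \<omega> {1..n}) {1..k}) \<in>
      measurable (obs_filtration S n :: ('d, 'b) path measure) (PiM {1..k} (\<lambda>_. obs S))"
    by (rule measurable_compose[OF measurable_restrict_filtration measurable_restrict_subset]) (use assms in auto)
  also have "(\<lambda>\<omega> :: ('d, 'b) path. restrict (restrict \<omega> {1..n}) {1..k}) = (\<lambda>\<omega>. restrict \<omega> {1..k})"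
    using assms by (auto simp: fun_eq_iff)
  finally have "sets (obs_filtration S k :: ('d, 'b) path measure) \<subseteq> sets (obs_filtration S n)"
    unfolding obs_filtration_def[of S k] by (intro sets_image_in_sets space_obs_filtration)
  then show ?thesis
    by (simp add: subalgebra_def)
qed

lemma measurable_filtration_mono:
  "f \<in> measurable (obs_filtration S k) N \<Longrightarrow> k \<le> n \<Longrightarrow> f \<in> measurable (obs_filtration S n) N"
  using measurable_from_subalg[OF subalgebra_obs_filtration_mono] by blast

lemma measurable_filtration_path:
  "f \<in> measurable (obs_filtration S k) N \<Longrightarrow> f \<in> measurable (path_space S) N"
  using measurable_from_subalg[OF subalgebra_obs_filtration] by blast

lemma measurable_evec_filtration:
  assumes "1 \<le> i" "i \<le> n"
  shows "evec i \<in> borel_measurable (obs_filtration S n)"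
proof -
  have "(\<lambda>\<omega>. fst (restrict \<omega> {1..n} i)) \<in> borel_measurable (obs_filtration S n)"
    by (rule measurable_compose[OF measurable_restrict_filtration],
        rule measurable_compose[OF measurable_component_singleton])
       (use assms in simp, rule measurable_fst_obs)
  also have "(\<lambda>\<omega>. fst (restrict \<omega> {1..n} i)) = evec i"
    using assms by (simp add: evec_def fun_eq_iff)
  finally show ?thesis .
qed

lemma measurable_evec_path: "1 \<le> i \<Longrightarrow> evec i \<in> borel_measurable (path_space S)"
  by (rule measurable_filtration_path[OF measurable_evec_filtration]) auto

lemma evec_nonneg: "\<omega> \<in> space (path_space S) \<Longrightarrow> 1 \<le> i \<Longrightarrow> 0 \<le> evec i \<omega> $ j"
  by (auto simp: path_space_def obs_def evec_def space_PiM space_pair_measure PiE_iff space_restrict_space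
      mem_Times_iff)

lemma filtration_measurable_eq:
  fixes f :: "('d::finite, 'b) path \<Rightarrow> ennreal"
  assumes f: "f \<in> borel_measurable (obs_filtration S n)"
    and \<omega>: "\<omega> \<in> space (path_space S)" "\<omega>' \<in> space (path_space S)" "\<And>i. 1 \<le> i \<Longrightarrow> i \<le> n \<Longrightarrow> \<omega> i = \<omega>' i"
  shows "f \<omega> = f \<omega>'"
proof -
  have "f -` {f \<omega>} \<inter> space (path_space S) \<in> sets (obs_filtration S n)"
    using measurable_sets[OF f, of "{f \<omega>}"] by simp
  then obtain B where B: "f -` {f \<omega>} \<inter> space (path_space S) = (\<lambda>\<omega>. restrict \<omega> {1..n}) -` B \<inter> space (path_space S)"
    unfolding sets_obs_filtration by auto
  have "restrict \<omega> {1..n} = restrict \<omega>' {1..n}"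
    using \<omega>(3) by (auto simp: fun_eq_iff)
  moreover have "\<omega> \<in> f -` {f \<omega>} \<inter> space (path_space S)"
    using \<omega>(1) by simp
  ultimately have "\<omega>' \<in> f -` {f \<omega>} \<inter> space (path_space S)"
    using \<omega>(2) unfolding B by simp
  then show ?thesis
    by simp
qed

section \<open>Independence\<close>

lemma (in prob_space) indep_var_of_indep_set:
  assumes "indep_set (sets A) (sets B)" "space A = space M" "space B = space M"
    and "f \<in> measurable A N" "h \<in> measurable B N'"
  shows "indep_var N f N' h"
proof -
  have sub: "sets A \<subseteq> sets M" "sets B \<subseteq> sets M"
    using assms(1) by (auto dest: indep_setD_ev1 indep_setD_ev2)
  have rv: "random_variable N f" "random_variable N' h"
    using assms sub by (auto simp: measurable_def)
  have "sigma_sets (space M) {f -` C \<inter> space M |C. C \<in> sets N} \<subseteq> sets A"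
    unfolding assms(2)[symmetric] using assms(4) by (intro sets.sigma_sets_subset) auto
  moreover have "sigma_sets (space M) {h -` C \<inter> space M |C. C \<in> sets N'} \<subseteq> sets B"
    unfolding assms(3)[symmetric] using assms(5) by (intro sets.sigma_sets_subset) auto
  ultimately have "indep_set (sigma_sets (space M) {f -` C \<inter> space M |C. C \<in> sets N})
      (sigma_sets (space M) {h -` C \<inter> space M |C. C \<in> sets N'})"
    using assms(1) unfolding indep_set_def
    by (elim indep_sets_mono_sets) (auto split: bool.split)
  with rv show ?thesis
    by (simp add: indep_var_eq)
qed

lemma (in prob_space) indep_var_nn_integral:
  fixes f h :: "'a \<Rightarrow> ennreal"
  assumes "indep_var borel f borel h"
  shows "(\<integral>\<^sup>+\<omega>. f \<omega> * h \<omega> \<partial>M) = (\<integral>\<^sup>+\<omega>. f \<omega> \<partial>M) * (\<integral>\<^sup>+\<omega>. h \<omega> \<partial>M)"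
proof -
  have "indep_vars (\<lambda>_. borel) (case_bool f h) UNIV"
    using assms by (simp add: indep_var_def case_bool_if if_distrib cong: indep_vars_cong)
  from indep_vars_nn_integral[OF _ this] show ?thesis
    by (simp add: UNIV_bool ac_simps)
qed

text \<open>
  Joint independence comes for free from independence of the respective past: in a finite intersection,
  split off the event with the largest index, the others being events of the past. The factor \<open>d A\<close> does
  not depend on the time, which makes the vectors identically distributed.
\<close>

lemma iid_distI:
  fixes P :: "('d::finite, 'b) path measure" and d :: "(real^'d) set \<Rightarrow> ennreal"
  assumes P: "prob_space P" and sets_P: "sets P = sets (path_space S)"
    and d: "\<And>k A B. A \<in> sets borel \<Longrightarrow> B \<in> sets (obs_filtration S k) \<Longrightarrow>
      emeasure P (evec (Suc k) -` A \<inter> space P \<inter> B) = d A * emeasure P B"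
  shows "iid_dist S P"
proof -
  interpret prob_space P by (rule P)
  have space_P: "space P = space (path_space S)"
    using sets_P by (rule sets_eq_imp_space_eq)
  have evec_meas[measurable]: "evec n \<in> borel_measurable P" if "1 \<le> n" for n
    using measurable_evec_path[OF that, of S] sets_P by (simp cong: measurable_cong_sets)
  have F_sub: "B \<in> sets P" if "B \<in> sets (obs_filtration S k)" for B k
    using that subalgebra_obs_filtration[of S k] sets_P by (auto simp: subalgebra_def)
  have marginal: "emeasure P (evec (Suc k) -` A \<inter> space P) = d A" if "A \<in> sets borel" for k A
    using d[OF that, of "space P" k] sets.top[of "obs_filtration S k"] emeasure_space_1
    by (simp add: space_P Int_absorb2)
  have mult: "prob (evec (Suc k) -` A \<inter> space P \<inter> B) = prob (evec (Suc k) -` A \<inter> space P) * prob B"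
    if "A \<in> sets borel" "B \<in> sets (obs_filtration S k)" for k A B
  proof -
    have "ennreal (prob (evec (Suc k) -` A \<inter> space P \<inter> B)) =
        ennreal (prob (evec (Suc k) -` A \<inter> space P)) * ennreal (prob B)"
      using d[OF that] unfolding marginal[OF that(1), of k, symmetric] emeasure_eq_measure .
    then show ?thesis
      by (simp flip: ennreal_mult)
  qed
  have "indep_vars (\<lambda>_. borel) evec {1..}"
    unfolding indep_vars_def2
  proof (intro conjI ballI indep_setsI)
    fix A :: "nat \<Rightarrow> ('d, 'b) path set" and J
    assume "J \<noteq> {}" and J: "J \<subseteq> {1..}" "finite J"
      and A: "\<forall>j\<in>J. A j \<in> {evec j -` C \<inter> space P |C. C \<in> sets borel}"
    \<comment> \<open>Intersecting with the space covers the empty index set, and inserting \<open>0\<close> gives it a maximum.\<close>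
    have "(\<Inter>j\<in>J. A j) \<inter> space P \<in> sets (obs_filtration S (Max (insert 0 J))) \<and>
        prob ((\<Inter>j\<in>J. A j) \<inter> space P) = (\<Prod>j\<in>J. prob (A j))"
      using J(2,1) A
    proof (induction J rule: finite_linorder_max_induct)
      case empty
      then show ?case using sets.top[of "obs_filtration S 0"] prob_space by (simp add: space_P)
    next
      case (insert b J)
      then obtain k where b: "b = Suc k" by (cases b) auto
      obtain C where C: "C \<in> sets borel" "A b = evec b -` C \<inter> space P"
        using insert.prems by auto
      have k: "Max (insert 0 J) \<le> k"
        using insert.hyps b by auto
      let ?B = "(\<Inter>j\<in>J. A j) \<inter> space P"
      have B: "?B \<in> sets (obs_filtration S k)"
        using insert.IH insert.prems subalgebra_obs_filtration_mono[OF k, of S] by (auto simp: subalgebra_def)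
      have Max: "Max (insert 0 (insert b J)) = b"
        using insert.hyps by (intro Max_eqI) (auto simp: less_imp_le)
      have eq: "(\<Inter>j\<in>insert b J. A j) \<inter> space P = evec (Suc k) -` C \<inter> space P \<inter> ?B"
        using C b by auto
      have "evec (Suc k) -` C \<inter> space P \<in> sets (obs_filtration S (Suc k))"
        using measurable_sets[OF measurable_evec_filtration[of "Suc k" "Suc k" S] C(1)] by (simp add: space_P)
      moreover have "?B \<in> sets (obs_filtration S (Suc k))"
        using B subalgebra_obs_filtration_mono[of k "Suc k" S] by (auto simp: subalgebra_def)
      ultimately have "(\<Inter>j\<in>insert b J. A j) \<inter> space P \<in> sets (obs_filtration S b)"
        unfolding eq unfolding b by (rule sets.Int)
      moreover have "prob ((\<Inter>j\<in>insert b J. A j) \<inter> space P) = (\<Prod>j\<in>insert b J. prob (A j))"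
        unfolding eq mult[OF C(1) B] using insert C b by auto
      ultimately show ?case
        unfolding Max by blast
    qed
    moreover have "(\<Inter>j\<in>J. A j) \<inter> space P = (\<Inter>j\<in>J. A j)"
      using \<open>J \<noteq> {}\<close> A by auto
    ultimately show "prob (\<Inter>j\<in>J. A j) = (\<Prod>j\<in>J. prob (A j))"
      by simp
  qed auto
  moreover have "distr P borel (evec n) = distr P borel (evec 1)" if "1 \<le> n" for n
  proof (rule measure_eqI)
    fix A assume "A \<in> sets (distr P borel (evec n))"
    then show "emeasure (distr P borel (evec n)) A = emeasure (distr P borel (evec 1)) A"
      using that marginal[of A "n - 1"] marginal[of A 0] by (simp add: emeasure_distr)
  qed simp
  moreover have "indep_set (sets (vimage_algebra (space (path_space S)) (evec n) borel)) (sets (obs_filtration S (n - 1)))"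
    if n: "1 \<le> n" for n
  proof (rule indep_setI)
    show "sets (vimage_algebra (space (path_space S)) (evec n) borel) \<subseteq> events"
      using n by (auto simp: sets_vimage_algebra2 space_P[symmetric])
    show "sets (obs_filtration S (n - 1)) \<subseteq> events"
      using F_sub by auto
    fix a b :: "('d, 'b) path set"
    assume "a \<in> sets (vimage_algebra (space (path_space S)) (evec n) borel)" and b: "b \<in> sets (obs_filtration S (n - 1))"
    then obtain A where "A \<in> sets borel" "a = evec n -` A \<inter> space P"
      by (auto simp: sets_vimage_algebra2 space_P)
    then show "prob (a \<inter> b) = prob a * prob b"
      using mult[of A b "n - 1"] b n by simp
  qed
  ultimately show ?thesis
    unfolding iid_dist_def using P sets_P by blast
qed

section \<open>Null distributions dominating a tilted alternative\<close>

text \<open>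
  The function \<open>g\<close> serves as a density of a new law for the vectors with respect to their law under \<open>Q\<close>.
  Its total mass \<open>m\<close> may be less than 1; the new law is completed by an atom at the zero vector, which
  contributes nothing to the means of the coordinates. The goal is a distribution of the whole
  path, observations in \<open>S\<close> included, that dominates the measure with density \<open>g (E\<^sub>1) * \<dots> * g (E\<^sub>n)\<close> with
  respect to \<open>Q\<close> on all events up to time \<open>n\<close>, not just on those of the vectors.
\<close>

locale iid_likelihood_ratio =
  fixes S :: "'b measure" and Q :: "('d::finite, 'b) path measure"
    and g :: "real^'d \<Rightarrow> ennreal" and m :: real
  assumes iid: "iid_dist S Q" and g_meas[measurable]: "g \<in> borel_measurable borel"
    and mass: "(\<integral>\<^sup>+\<omega>. g (evec 1 \<omega>) \<partial>Q) = ennreal m" and m_pos: "0 < m" and m_le: "m \<le> 1"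
begin

sublocale prob_space Q
  using iid by (simp add: iid_dist_def)

lemma sets_Q[measurable_cong]: "sets Q = sets (path_space S)"
  using iid by (simp add: iid_dist_def)

lemma space_Q: "space Q = space (path_space S)"
  by (rule sets_eq_imp_space_eq[OF sets_Q])

definition likelihood :: "nat \<Rightarrow> ('d, 'b) path \<Rightarrow> ennreal" where
  "likelihood n \<omega> = (\<Prod>i\<in>{1..n}. g (evec i \<omega>))"

lemma likelihood_0[simp]: "likelihood 0 \<omega> = 1"
  by (simp add: likelihood_def)

lemma likelihood_Suc: "likelihood (Suc n) \<omega> = likelihood n \<omega> * g (evec (Suc n) \<omega>)"
  by (simp add: likelihood_def)

lemma measurable_likelihood: "k \<le> n \<Longrightarrow> likelihood k \<in> borel_measurable (obs_filtration S n)"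
  unfolding likelihood_def
  by (intro borel_measurable_prod_ennreal measurable_compose[OF measurable_evec_filtration g_meas]) auto

lemma measurable_filtration_Q: "f \<in> measurable (obs_filtration S k) N \<Longrightarrow> f \<in> measurable Q N"
  using measurable_filtration_path by (simp cong: measurable_cong_sets add: sets_Q)

lemma measurable_likelihood_Q[measurable]: "likelihood n \<in> borel_measurable Q"
  by (rule measurable_filtration_Q[OF measurable_likelihood[OF order_refl]])

lemma measurable_evec_Q: "1 \<le> i \<Longrightarrow> evec i \<in> borel_measurable Q"
  using measurable_evec_path by (simp cong: measurable_cong_sets add: sets_Q)

lemma nn_integral_mult_next:
  assumes f: "f \<in> borel_measurable (obs_filtration S k)" and \<phi>: "\<phi> \<in> borel_measurable borel"
  shows "(\<integral>\<^sup>+\<omega>. f \<omega> * \<phi> (evec (Suc k) \<omega>) \<partial>Q) = (\<integral>\<^sup>+\<omega>. f \<omega> \<partial>Q) * (\<integral>\<^sup>+\<omega>. \<phi> (evec 1 \<omega>) \<partial>Q)"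
proof -
  have "indep_set (sets (vimage_algebra (space (path_space S)) (evec (Suc k)) borel)) (sets (obs_filtration S (Suc k - 1)))"
    using iid unfolding iid_dist_def by (metis le_add1 plus_1_eq_Suc)
  then have ind: "indep_set (sets (vimage_algebra (space (path_space S)) (evec (Suc k)) borel)) (sets (obs_filtration S k))"
    by simp
  have "evec (Suc k) \<in> borel_measurable (vimage_algebra (space (path_space S)) (evec (Suc k)) borel)"
    by (rule measurable_vimage_algebra1) simp
  from measurable_compose[OF this \<phi>]
  have "indep_var borel (\<lambda>\<omega>. \<phi> (evec (Suc k) \<omega>)) borel f"
    using f by (rule indep_var_of_indep_set[OF ind, rotated 2]) (simp_all only: space_Q space_vimage_algebra space_obs_filtration)
  then have "(\<integral>\<^sup>+\<omega>. \<phi> (evec (Suc k) \<omega>) * f \<omega> \<partial>Q) = (\<integral>\<^sup>+\<omega>. \<phi> (evec (Suc k) \<omega>) \<partial>Q) * (\<integral>\<^sup>+\<omega>. f \<omega> \<partial>Q)"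
    by (rule indep_var_nn_integral)
  moreover have "(\<integral>\<^sup>+\<omega>. \<phi> (evec (Suc k) \<omega>) \<partial>Q) = (\<integral>\<^sup>+\<omega>. \<phi> (evec 1 \<omega>) \<partial>Q)"
  proof -
    have eq: "distr Q borel (evec (Suc k)) = distr Q borel (evec 1)"
      using iid unfolding iid_dist_def by (metis le_add1 plus_1_eq_Suc)
    have "(\<integral>\<^sup>+\<omega>. \<phi> (evec (Suc k) \<omega>) \<partial>Q) = (\<integral>\<^sup>+x. \<phi> x \<partial>distr Q borel (evec (Suc k)))"
      by (rule nn_integral_distr[symmetric]) (use measurable_evec_Q \<phi> in auto)
    also have "\<dots> = (\<integral>\<^sup>+\<omega>. \<phi> (evec 1 \<omega>) \<partial>Q)"
      unfolding eq by (rule nn_integral_distr) (use measurable_evec_Q \<phi> in auto)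
    finally show ?thesis .
  qed
  ultimately show ?thesis
    by (simp add: mult.commute)
qed

text \<open>
  Each likelihood factor after time \<open>n\<close> is independent of its past and has mean \<open>m\<close>.
\<close>

lemma nn_integral_mult_likelihood:
  assumes "n \<le> N" "f \<in> borel_measurable (obs_filtration S n)"
  shows "(\<integral>\<^sup>+\<omega>. f \<omega> * likelihood N \<omega> \<partial>Q) = ennreal (m ^ (N - n)) * (\<integral>\<^sup>+\<omega>. f \<omega> * likelihood n \<omega> \<partial>Q)"
  using assms(1)
proof (induction N rule: dec_induct)
  case (step N)
  have [measurable]: "f \<in> borel_measurable (obs_filtration S N)" "likelihood N \<in> borel_measurable (obs_filtration S N)"
    using assms(2) step(1) by (auto intro: measurable_filtration_mono measurable_likelihood)
  have "(\<integral>\<^sup>+\<omega>. f \<omega> * likelihood (Suc N) \<omega> \<partial>Q) = (\<integral>\<^sup>+\<omega>. f \<omega> * likelihood N \<omega> * g (evec (Suc N) \<omega>) \<partial>Q)"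
    by (simp add: likelihood_Suc mult.assoc)
  also have "\<dots> = (\<integral>\<^sup>+\<omega>. f \<omega> * likelihood N \<omega> \<partial>Q) * ennreal m"
    unfolding mass[symmetric] by (subst nn_integral_mult_next) simp_all
  also have "\<dots> = ennreal (m ^ (Suc N - n)) * (\<integral>\<^sup>+\<omega>. f \<omega> * likelihood n \<omega> \<partial>Q)"
    unfolding step.IH using step.hyps m_pos by (simp add: Suc_diff_le ennreal_mult mult_ac)
  finally show ?case .
qed simp

text \<open>
  The first \<open>N\<close> vectors get the normalised density \<open>g / m\<close>. The horizon has to be finite: on an
  infinite horizon the new measure is in general singular to \<open>Q\<close>, and it need not exist, since the other
  observations take values in an arbitrary measurable space, where no extension theorem applies.
\<close>

definition tilted :: "nat \<Rightarrow> ('d, 'b) path measure" where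
  "tilted N = density Q (\<lambda>\<omega>. likelihood N \<omega> * ennreal (1 / m ^ N))"

lemma sets_tilted[measurable_cong]: "sets (tilted N) = sets (path_space S)"
  by (simp add: tilted_def sets_Q)

lemma space_tilted: "space (tilted N) = space (path_space S)"
  by (simp add: tilted_def space_Q)

lemma nn_integral_tilted:
  assumes n: "n \<le> N" and f: "f \<in> borel_measurable (obs_filtration S n)"
  shows "(\<integral>\<^sup>+\<omega>. f \<omega> \<partial>tilted N) = ennreal (1 / m ^ n) * (\<integral>\<^sup>+\<omega>. f \<omega> * likelihood n \<omega> \<partial>Q)"
proof -
  have [measurable]: "f \<in> borel_measurable Q"
    by (rule measurable_filtration_Q[OF f])
  have "(\<integral>\<^sup>+\<omega>. f \<omega> \<partial>tilted N) = (\<integral>\<^sup>+\<omega>. ennreal (1 / m ^ N) * (f \<omega> * likelihood N \<omega>) \<partial>Q)"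
    unfolding tilted_def by (subst nn_integral_density) (auto simp: mult_ac)
  also have "\<dots> = ennreal (1 / m ^ N) * (ennreal (m ^ (N - n)) * (\<integral>\<^sup>+\<omega>. f \<omega> * likelihood n \<omega> \<partial>Q))"
    by (subst nn_integral_cmult) (auto simp: nn_integral_mult_likelihood[OF n f])
  also have "\<dots> = ennreal (1 / m ^ N * m ^ (N - n)) * (\<integral>\<^sup>+\<omega>. f \<omega> * likelihood n \<omega> \<partial>Q)"
    using m_pos by (subst ennreal_mult) (simp_all add: mult.assoc)
  also have "1 / m ^ N * m ^ (N - n) = 1 / m ^ n"
    using m_pos n by (simp add: power_diff field_simps)
  finally show ?thesis .
qed

lemma prob_space_tilted: "prob_space (tilted N)"
proof
  have "emeasure (tilted N) (space (tilted N)) = (\<integral>\<^sup>+\<omega>. 1 \<partial>tilted N)"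
    by simp
  also have "\<dots> = 1"
    by (subst nn_integral_tilted[of 0]) (auto simp: emeasure_space_1)
  finally show "emeasure (tilted N) (space (tilted N)) = 1" .
qed

lemma nn_integral_tilted_next:
  assumes k: "Suc k \<le> N" and f: "f \<in> borel_measurable (obs_filtration S k)" and \<phi>: "\<phi> \<in> borel_measurable borel"
  shows "(\<integral>\<^sup>+\<omega>. \<phi> (evec (Suc k) \<omega>) * f \<omega> \<partial>tilted N) = (\<integral>\<^sup>+\<omega>. \<phi> (evec 1 \<omega>) \<partial>tilted 1) * (\<integral>\<^sup>+\<omega>. f \<omega> \<partial>tilted N)"
proof -
  have [measurable]: "f \<in> borel_measurable (obs_filtration S (Suc k))"
      "evec (Suc k) \<in> borel_measurable (obs_filtration S (Suc k))" "\<phi> \<in> borel_measurable borel"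
      "likelihood k \<in> borel_measurable (obs_filtration S k)" "f \<in> borel_measurable (obs_filtration S k)"
    using f \<phi> by (auto intro: measurable_filtration_mono measurable_likelihood measurable_evec_filtration)
  have "(\<integral>\<^sup>+\<omega>. \<phi> (evec (Suc k) \<omega>) * f \<omega> \<partial>tilted N) =
      ennreal (1 / m ^ Suc k) * (\<integral>\<^sup>+\<omega>. f \<omega> * likelihood k \<omega> * (\<phi> (evec (Suc k) \<omega>) * g (evec (Suc k) \<omega>)) \<partial>Q)"
    by (subst nn_integral_tilted[OF k]) (auto simp: likelihood_Suc mult_ac)
  also have "\<dots> = ennreal (1 / m ^ Suc k) * ((\<integral>\<^sup>+\<omega>. f \<omega> * likelihood k \<omega> \<partial>Q) * (\<integral>\<^sup>+\<omega>. \<phi> (evec 1 \<omega>) * g (evec 1 \<omega>) \<partial>Q))"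
    by (subst nn_integral_mult_next[of _ k "\<lambda>x. \<phi> x * g x"]) auto
  also have "ennreal (1 / m ^ Suc k) = ennreal (1 / m ^ k) * ennreal (1 / m)"
    using m_pos by (simp add: mult.commute flip: ennreal_mult)
  also have "ennreal (1 / m ^ k) * ennreal (1 / m) * ((\<integral>\<^sup>+\<omega>. f \<omega> * likelihood k \<omega> \<partial>Q) * (\<integral>\<^sup>+\<omega>. \<phi> (evec 1 \<omega>) * g (evec 1 \<omega>) \<partial>Q))
     = (ennreal (1 / m ^ 1) * (\<integral>\<^sup>+\<omega>. \<phi> (evec 1 \<omega>) * likelihood 1 \<omega> \<partial>Q)) * (ennreal (1 / m ^ k) * (\<integral>\<^sup>+\<omega>. f \<omega> * likelihood k \<omega> \<partial>Q))"
    by (simp add: likelihood_def mult_ac)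
  also have "ennreal (1 / m ^ k) * (\<integral>\<^sup>+\<omega>. f \<omega> * likelihood k \<omega> \<partial>Q) = (\<integral>\<^sup>+\<omega>. f \<omega> \<partial>tilted N)"
    using k f by (subst nn_integral_tilted[of k]) auto
  also have "ennreal (1 / m ^ 1) * (\<integral>\<^sup>+\<omega>. \<phi> (evec 1 \<omega>) * likelihood 1 \<omega> \<partial>Q) = (\<integral>\<^sup>+\<omega>. \<phi> (evec 1 \<omega>) \<partial>tilted 1)"
    by (rule nn_integral_tilted[symmetric], rule order_refl,
        rule measurable_compose[OF measurable_evec_filtration \<phi>]) simp_all
  finally show ?thesis .
qed

text \<open>
  The auxiliary randomness used at one time: a coin that shows \<open>True\<close> (survival) with
  probability \<open>m\<close>, and an independent observation whose vector has the normalised density.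
\<close>

definition fresh :: "(bool \<times> (real^'d) \<times> 'b) measure" where
  "fresh = measure_pmf (bernoulli_pmf m) \<Otimes>\<^sub>M distr (tilted 1) (obs S) (\<lambda>\<omega>. \<omega> 1)"

definition fresh_path :: "(nat \<Rightarrow> bool \<times> (real^'d) \<times> 'b) measure" where
  "fresh_path = PiM {1..} (\<lambda>_. fresh)"

definition zero_obs :: "(real^'d) \<times> 'b" where
  "zero_obs = (0, SOME b. b \<in> space S)"

text \<open>
  At time \<open>i\<close> a failed coin replaces the observation by one with vector \<open>0\<close>; otherwise the given
  observation \<open>x\<close> is kept up to the horizon \<open>N\<close>, and the auxiliary one is used afterwards, because the
  given vectors have the wrong law beyond \<open>N\<close>.
\<close>

definition splice_obs :: "nat \<Rightarrow> nat \<Rightarrow> bool \<times> (real^'d) \<times> 'b \<Rightarrow> (real^'d) \<times> 'b \<Rightarrow> (real^'d) \<times> 'b" where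
  "splice_obs N i u x = (if fst u then if i \<le> N then x else snd u else zero_obs)"

definition splice_path :: "nat \<Rightarrow> nat set \<Rightarrow> (nat \<Rightarrow> bool \<times> (real^'d) \<times> 'b) \<Rightarrow> ('d, 'b) path \<Rightarrow> ('d, 'b) path" where
  "splice_path N J \<eta> \<omega> = (\<lambda>i\<in>J. splice_obs N i (\<eta> i) (\<omega> i))"

text \<open>
  Under this distribution each vector is, independently of the past, \<open>0\<close> with probability \<open>1 - m\<close> and
  otherwise drawn with the normalised density; this holds at all times, before and after \<open>N\<close>.
\<close>

definition killed :: "nat \<Rightarrow> ('d, 'b) path measure" where
  "killed N = distr (fresh_path \<Otimes>\<^sub>M tilted N) (path_space S) (\<lambda>(\<eta>, \<omega>). splice_path N {1..} \<eta> \<omega>)"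

lemma measurable_coord_path: "1 \<le> i \<Longrightarrow> (\<lambda>\<omega>. \<omega> i) \<in> measurable (path_space S) (obs S)"
  unfolding path_space_def by (rule measurable_component_singleton) auto

lemma sets_fresh[measurable_cong]: "sets fresh = sets (count_space UNIV \<Otimes>\<^sub>M obs S)"
  unfolding fresh_def by (rule sets_pair_measure_cong) auto

lemma sets_fresh_path[measurable_cong]: "sets fresh_path = sets (PiM {1..} (\<lambda>_. count_space UNIV \<Otimes>\<^sub>M obs S))"
  unfolding fresh_path_def by (rule sets_PiM_cong) (auto simp: sets_fresh)

lemma prob_space_fresh: "prob_space fresh"
  unfolding fresh_def
  by (intro prob_space_pair prob_space_measure_pmf prob_space.prob_space_distr prob_space_tilted)
     (simp add: measurable_cong_sets[OF sets_tilted refl] measurable_coord_path)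

sublocale fresh: product_prob_space "\<lambda>_. fresh" "{1..} :: nat set"
  using prob_space_fresh
  by (simp add: product_prob_space_def product_prob_space_axioms_def product_sigma_finite_def prob_space_imp_sigma_finite)

lemma zero_obs_in_space: "zero_obs \<in> space (obs S)"
proof -
  obtain \<omega> :: "('d, 'b) path" where "\<omega> \<in> space (path_space S)"
    using not_empty space_Q by auto
  then have "\<omega> 1 \<in> space (obs S)"
    by (rule measurable_space[OF measurable_coord_path[OF order_refl]])
  then have "snd (\<omega> 1) \<in> space S"
    by (auto simp: obs_def space_pair_measure)
  then have "(SOME b. b \<in> space S) \<in> space S"
    by (rule someI)
  then show ?thesis
    by (simp add: zero_obs_def obs_def space_pair_measure space_restrict_space)
qed

lemma measurable_splice_obs[measurable]:
  "(\<lambda>(u, x). splice_obs N i u x) \<in> measurable ((count_space UNIV \<Otimes>\<^sub>M obs S) \<Otimes>\<^sub>M obs S) (obs S)"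
proof -
  have [measurable]: "zero_obs \<in> space (obs S)"
    by (rule zero_obs_in_space)
  show ?thesis
    unfolding splice_obs_def by measurable
qed

lemma measurable_splice_path:
  assumes "J \<subseteq> {1..}"
  shows "(\<lambda>(\<eta>, \<omega>). splice_path N J \<eta> \<omega>) \<in>
    measurable (PiM J (\<lambda>_. count_space UNIV \<Otimes>\<^sub>M obs S) \<Otimes>\<^sub>M PiM J (\<lambda>_. obs S)) (PiM J (\<lambda>_. obs S))"
  unfolding splice_path_def case_prod_beta
  by (rule measurable_restrict) measurable

lemma nn_integral_fresh:
  assumes [measurable]: "f \<in> borel_measurable fresh"
  shows "(\<integral>\<^sup>+u. f u \<partial>fresh) =
    ennreal m * (\<integral>\<^sup>+\<omega>. f (True, \<omega> 1) \<partial>tilted 1) + ennreal (1 - m) * (\<integral>\<^sup>+\<omega>. f (False, \<omega> 1) \<partial>tilted 1)"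
proof -
  have [measurable]: "(\<lambda>\<omega>. \<omega> 1) \<in> measurable (tilted 1) (obs S)"
    by (simp add: measurable_cong_sets[OF sets_tilted refl] measurable_coord_path)
  interpret L: prob_space "distr (tilted 1) (obs S) (\<lambda>\<omega>. \<omega> 1)"
    by (rule prob_space.prob_space_distr[OF prob_space_tilted]) measurable
  have "(\<integral>\<^sup>+u. f u \<partial>fresh) =
      (\<integral>\<^sup>+b. \<integral>\<^sup>+z. f (b, z) \<partial>distr (tilted 1) (obs S) (\<lambda>\<omega>. \<omega> 1) \<partial>measure_pmf (bernoulli_pmf m))"
    using assms unfolding fresh_def by (subst L.nn_integral_fst) simp_all
  also have "\<dots> = (\<integral>\<^sup>+b. \<integral>\<^sup>+\<omega>. f (b, \<omega> 1) \<partial>tilted 1 \<partial>measure_pmf (bernoulli_pmf m))"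
    by (intro nn_integral_cong nn_integral_distr) measurable
  also have "\<dots> = ennreal m * (\<integral>\<^sup>+\<omega>. f (True, \<omega> 1) \<partial>tilted 1) + ennreal (1 - m) * (\<integral>\<^sup>+\<omega>. f (False, \<omega> 1) \<partial>tilted 1)"
    using m_pos m_le by (subst nn_integral_bernoulli_pmf) (auto simp: mult.commute)
  finally show ?thesis .
qed

text \<open>
  The coordinates of a product measure are independent; the product over \<open>{1..Suc k}\<close> is split into
  its last factor and the product over \<open>{1..k}\<close>.
\<close>

lemma nn_integral_fresh_path_next:
  assumes [measurable]: "c \<in> borel_measurable fresh" "h \<in> borel_measurable (PiM {1..k} (\<lambda>_. fresh))"
  shows "(\<integral>\<^sup>+\<eta>. c (\<eta> (Suc k)) * h (restrict \<eta> {1..k}) \<partial>fresh_path) =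
    (\<integral>\<^sup>+u. c u \<partial>fresh) * (\<integral>\<^sup>+\<eta>. h (restrict \<eta> {1..k}) \<partial>fresh_path)"
proof -
  have marginal: "(\<integral>\<^sup>+\<eta>. f (restrict \<eta> {1..n}) \<partial>fresh_path) = (\<integral>\<^sup>+x. f x \<partial>PiM {1..n} (\<lambda>_. fresh))"
    if [measurable]: "f \<in> borel_measurable (PiM {1..n} (\<lambda>_. fresh))" for f :: "_ \<Rightarrow> ennreal" and n
  proof -
    have r: "(\<lambda>\<eta>. restrict \<eta> {1..n}) \<in> measurable fresh_path (PiM {1..n} (\<lambda>_. fresh))"
      unfolding fresh_path_def by (rule measurable_restrict_subset) auto
    have "(\<integral>\<^sup>+x. f x \<partial>PiM {1..n} (\<lambda>_. fresh)) = (\<integral>\<^sup>+x. f x \<partial>distr fresh_path (PiM {1..n} (\<lambda>_. fresh)) (\<lambda>\<eta>. restrict \<eta> {1..n}))"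
      unfolding fresh_path_def by (subst fresh.distr_PiM_restrict_finite) auto
    also have "\<dots> = (\<integral>\<^sup>+\<eta>. f (restrict \<eta> {1..n}) \<partial>fresh_path)"
      by (rule nn_integral_distr[OF r]) (use that in simp)
    finally show ?thesis ..
  qed
  have ins: "{1..Suc k} = insert (Suc k) {1..k}"
    by auto
  have [measurable]: "(\<lambda>x. restrict x {1..k}) \<in> measurable (PiM {1..Suc k} (\<lambda>_. fresh)) (PiM {1..k} (\<lambda>_. fresh))"
    by (rule measurable_restrict_subset) auto
  have [measurable]: "(\<lambda>x. x (Suc k)) \<in> measurable (PiM {1..Suc k} (\<lambda>_. fresh)) fresh"
    by (rule measurable_component_singleton) auto
  have F: "(\<lambda>x. c (x (Suc k)) * h (restrict x {1..k})) \<in> borel_measurable (PiM {1..Suc k} (\<lambda>_. fresh))"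
    by measurable
  have "restrict (restrict \<eta> {1..Suc k}) {1..k} = restrict \<eta> {1..k}" for \<eta> :: "nat \<Rightarrow> bool \<times> (real^'d) \<times> 'b"
    by (auto simp: fun_eq_iff)
  then have "(\<integral>\<^sup>+\<eta>. c (\<eta> (Suc k)) * h (restrict \<eta> {1..k}) \<partial>fresh_path) =
      (\<integral>\<^sup>+x. c (x (Suc k)) * h (restrict x {1..k}) \<partial>PiM {1..Suc k} (\<lambda>_. fresh))"
    using marginal[OF F] by simp
  also have "\<dots> = (\<integral>\<^sup>+x. \<integral>\<^sup>+y. c ((x(Suc k := y)) (Suc k)) * h (restrict (x(Suc k := y)) {1..k}) \<partial>fresh \<partial>PiM {1..k} (\<lambda>_. fresh))"
    using F unfolding ins by (intro fresh.product_nn_integral_insert) auto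
  also have "\<dots> = (\<integral>\<^sup>+x. (\<integral>\<^sup>+y. c y \<partial>fresh) * h x \<partial>PiM {1..k} (\<lambda>_. fresh))"
  proof (rule nn_integral_cong)
    fix x assume x: "x \<in> space (PiM {1..k} (\<lambda>_. fresh))"
    have "restrict (x(Suc k := y)) {1..k} = x" for y
      using x by (auto simp: space_PiM PiE_iff extensional_def fun_eq_iff)
    then show "(\<integral>\<^sup>+y. c ((x(Suc k := y)) (Suc k)) * h (restrict (x(Suc k := y)) {1..k}) \<partial>fresh) =
        (\<integral>\<^sup>+y. c y \<partial>fresh) * h x"
      by (simp add: nn_integral_multc)
  qed
  also have "\<dots> = (\<integral>\<^sup>+u. c u \<partial>fresh) * (\<integral>\<^sup>+\<eta>. h (restrict \<eta> {1..k}) \<partial>fresh_path)"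
    unfolding marginal[OF assms(2)] by (rule nn_integral_cmult) (rule assms(2))
  finally show ?thesis .
qed

lemma measurable_killing:
  "(\<lambda>(\<eta>, \<omega>). splice_path N {1..} \<eta> \<omega>) \<in> measurable (fresh_path \<Otimes>\<^sub>M tilted N) (path_space S)"
  using measurable_splice_path[OF order_refl, of N] unfolding path_space_def
  by (simp add: measurable_cong_sets[OF sets_pair_measure_cong[OF sets_fresh_path sets_tilted] refl] path_space_def)

lemma prob_space_fresh_path: "prob_space fresh_path"
  unfolding fresh_path_def by (rule fresh.P.prob_space_axioms)

lemma prob_space_killed: "prob_space (killed N)"
  unfolding killed_def
  by (intro prob_space.prob_space_distr[OF _ measurable_killing] prob_space_pair prob_space_fresh_path prob_space_tilted)

lemma sets_killed[measurable_cong]: "sets (killed N) = sets (path_space S)"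
  by (simp add: killed_def)

lemma space_killed: "space (killed N) = space (path_space S)"
  by (simp add: killed_def)

lemma nn_integral_killed:
  assumes f: "f \<in> borel_measurable (path_space S)"
  shows "(\<integral>\<^sup>+\<omega>. f \<omega> \<partial>killed N) = (\<integral>\<^sup>+\<eta>. \<integral>\<^sup>+\<omega>. f (splice_path N {1..} \<eta> \<omega>) \<partial>tilted N \<partial>fresh_path)"
proof -
  interpret T: prob_space "tilted N"
    by (rule prob_space_tilted)
  have "(\<integral>\<^sup>+\<omega>. f \<omega> \<partial>killed N) = (\<integral>\<^sup>+p. f (case_prod (splice_path N {1..}) p) \<partial>(fresh_path \<Otimes>\<^sub>M tilted N))"
    unfolding killed_def by (rule nn_integral_distr[OF measurable_killing]) (use f in simp)
  also have "\<dots> = (\<integral>\<^sup>+\<eta>. \<integral>\<^sup>+\<omega>. f (case_prod (splice_path N {1..}) (\<eta>, \<omega>)) \<partial>tilted N \<partial>fresh_path)"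
    by (rule T.nn_integral_fst[symmetric]) (rule measurable_compose[OF measurable_killing f])
  finally show ?thesis
    by simp
qed

lemma splice_path_in_space:
  assumes "\<eta> \<in> space fresh_path" "\<omega> \<in> space (path_space S)"
  shows "splice_path N {1..} \<eta> \<omega> \<in> space (path_space S)"
  using measurable_space[OF measurable_killing, of "(\<eta>, \<omega>)"] assms
  by (simp add: space_pair_measure space_tilted)

lemma restrict_splice_path:
  "restrict (splice_path N {1..} \<eta> \<omega>) {1..k} = splice_path N {1..k} (restrict \<eta> {1..k}) (restrict \<omega> {1..k})"
  by (auto simp: splice_path_def fun_eq_iff)

lemma evec_splice_path:
  "evec (Suc k) (splice_path N {1..} \<eta> \<omega>) =
    (if fst (\<eta> (Suc k)) then if Suc k \<le> N then evec (Suc k) \<omega> else fst (snd (\<eta> (Suc k))) else 0)"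
  by (simp add: evec_def splice_path_def splice_obs_def zero_obs_def)

text \<open>
  Independence of the next vector from the past, with the same law at all times. With the auxiliary
  randomness fixed, the past is an event of the past of the tilted path, so the next tilted vector can be
  integrated out. What remains is a function of the next coin and auxiliary observation (\<open>c\<close> in the
  proof) times a function of the previous ones (\<open>h\<close> in the proof), and these are independent. The mean of
  \<open>c\<close> is the same before and after the horizon since the auxiliary vectors have the law of the tilted ones.
\<close>

lemma nn_integral_killed_next:
  assumes B: "B \<in> sets (obs_filtration S k)" and \<phi>[measurable]: "\<phi> \<in> borel_measurable borel"
  shows "(\<integral>\<^sup>+\<omega>. \<phi> (evec (Suc k) \<omega>) * indicator B \<omega> \<partial>killed N) =
    (ennreal m * (\<integral>\<^sup>+\<omega>. \<phi> (evec 1 \<omega>) \<partial>tilted 1) + ennreal (1 - m) * \<phi> 0) * emeasure (killed N) B"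
proof -
  interpret T: prob_space "tilted N"
    by (rule prob_space_tilted)
  interpret T1: prob_space "tilted 1"
    by (rule prob_space_tilted)
  define \<gamma> where "\<gamma> = (\<integral>\<^sup>+\<omega>. \<phi> (evec 1 \<omega>) \<partial>tilted 1)"
  obtain C where C[measurable]: "C \<in> sets (PiM {1..k} (\<lambda>_. obs S))"
    and B_eq: "B = (\<lambda>\<omega>. restrict \<omega> {1..k}) -` C \<inter> space (path_space S)"
    using B unfolding sets_obs_filtration by auto
  have B_path: "B \<in> sets (path_space S)"
    using B subalgebra_obs_filtration[of S k] by (auto simp: subalgebra_def)
  have past: "(\<lambda>\<omega>. restrict \<omega> {1..k}) \<in> measurable (tilted N) (PiM {1..k} (\<lambda>_. obs S))"
    using measurable_restrict_path by (simp add: measurable_cong_sets[OF sets_tilted refl])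
  have fst_snd: "(\<lambda>u. fst (snd u)) \<in> borel_measurable fresh"
    using measurable_compose[OF measurable_snd measurable_fst_obs, of "count_space (UNIV :: bool set)" S]
    by (simp add: measurable_cong_sets[OF sets_fresh refl])
  define c where "c u = (if fst u then if Suc k \<le> N then \<gamma> else \<phi> (fst (snd u)) else \<phi> 0)" for u :: "bool \<times> (real^'d) \<times> 'b"
  have "Measurable.pred (count_space UNIV \<Otimes>\<^sub>M obs S) fst"
    by measurable
  then have [measurable]: "Measurable.pred fresh fst"
    by (simp add: measurable_cong_sets[OF sets_fresh refl])
  have c[measurable]: "c \<in> borel_measurable fresh"
    unfolding c_def using measurable_compose[OF fst_snd \<phi>] by measurable
  define h where "h \<zeta> = (\<integral>\<^sup>+\<omega>. indicator C (splice_path N {1..k} \<zeta> (restrict \<omega> {1..k})) \<partial>tilted N)" for \<zeta>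
  have joint: "(\<lambda>(\<zeta>, \<omega>). splice_path N {1..k} \<zeta> (restrict \<omega> {1..k})) \<in>
      measurable (PiM {1..k} (\<lambda>_. fresh) \<Otimes>\<^sub>M tilted N) (PiM {1..k} (\<lambda>_. obs S))"
  proof -
    have "sets (PiM {1..k} (\<lambda>_. fresh)) = sets (PiM {1..k} (\<lambda>_. count_space UNIV \<Otimes>\<^sub>M obs S))"
      by (rule sets_PiM_cong) (auto simp: sets_fresh)
    then have id: "(\<lambda>\<zeta>. \<zeta>) \<in> measurable (PiM {1..k} (\<lambda>_. fresh)) (PiM {1..k} (\<lambda>_. count_space UNIV \<Otimes>\<^sub>M obs S))"
      by (rule measurable_ident_sets)
    have "(\<lambda>p. (fst p, restrict (snd p) {1..k})) \<in> measurable (PiM {1..k} (\<lambda>_. fresh) \<Otimes>\<^sub>M tilted N)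
        (PiM {1..k} (\<lambda>_. count_space UNIV \<Otimes>\<^sub>M obs S) \<Otimes>\<^sub>M PiM {1..k} (\<lambda>_. obs S))"
      by (intro measurable_Pair measurable_compose[OF measurable_fst id] measurable_compose[OF measurable_snd past])
    from measurable_compose[OF this measurable_splice_path[of "{1..k}" N]] show ?thesis
      by (simp add: case_prod_beta)
  qed
  have h[measurable]: "h \<in> borel_measurable (PiM {1..k} (\<lambda>_. fresh))"
    unfolding h_def
    by (rule T.borel_measurable_nn_integral)
       (use measurable_compose[OF joint borel_measurable_indicator[OF C]] in \<open>simp only: case_prod_unfold\<close>)
  have ind: "indicator B (splice_path N {1..} \<eta> \<omega>) =
      (indicator C (splice_path N {1..k} (restrict \<eta> {1..k}) (restrict \<omega> {1..k})) :: ennreal)"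
    if "\<eta> \<in> space fresh_path" "\<omega> \<in> space (path_space S)" for \<eta> \<omega>
    using splice_path_in_space[OF that, of N] by (simp add: B_eq indicator_def restrict_splice_path[unfolded One_nat_def])
  have slice: "(\<lambda>x. splice_path N {1..k} (restrict \<eta> {1..k}) x) \<in> measurable (PiM {1..k} (\<lambda>_. obs S)) (PiM {1..k} (\<lambda>_. obs S))"
    if \<eta>: "\<eta> \<in> space fresh_path" for \<eta>
  proof -
    have "space fresh_path = space (PiM {1..} (\<lambda>_. count_space (UNIV :: bool set) \<Otimes>\<^sub>M obs S))"
      by (rule sets_eq_imp_space_eq[OF sets_fresh_path])
    then have "restrict \<eta> {1..k} \<in> space (PiM {1..k} (\<lambda>_. count_space UNIV \<Otimes>\<^sub>M obs S))"
      using \<eta> by (auto simp: space_PiM PiE_iff)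
    from measurable_compose[OF measurable_Pair1'[OF this] measurable_splice_path[of "{1..k}" N]]
    show ?thesis by simp
  qed
  have inner: "(\<integral>\<^sup>+\<omega>. \<phi> (evec (Suc k) (splice_path N {1..} \<eta> \<omega>)) * indicator B (splice_path N {1..} \<eta> \<omega>) \<partial>tilted N) =
      c (\<eta> (Suc k)) * h (restrict \<eta> {1..k})" if \<eta>: "\<eta> \<in> space fresh_path" for \<eta>
  proof -
    let ?f = "\<lambda>\<omega>. indicator C (splice_path N {1..k} (restrict \<eta> {1..k}) (restrict \<omega> {1..k})) :: ennreal"
    have f: "?f \<in> borel_measurable (obs_filtration S k)"
      by (intro measurable_compose[OF measurable_compose[OF measurable_restrict_filtration slice[OF \<eta>]]]
          borel_measurable_indicator C)
    have f': "?f \<in> borel_measurable (tilted N)"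
      using measurable_filtration_path[OF f] by (simp add: measurable_cong_sets[OF sets_tilted refl])
    have "(\<integral>\<^sup>+\<omega>. \<phi> (evec (Suc k) (splice_path N {1..} \<eta> \<omega>)) * indicator B (splice_path N {1..} \<eta> \<omega>) \<partial>tilted N) =
        (\<integral>\<^sup>+\<omega>. \<phi> (if fst (\<eta> (Suc k)) then if Suc k \<le> N then evec (Suc k) \<omega> else fst (snd (\<eta> (Suc k))) else 0) * ?f \<omega> \<partial>tilted N)"
      by (intro nn_integral_cong) (simp only: ind[OF \<eta>] evec_splice_path space_tilted)
    also have "\<dots> = c (\<eta> (Suc k)) * (\<integral>\<^sup>+\<omega>. ?f \<omega> \<partial>tilted N)"
    proof (cases "fst (\<eta> (Suc k)) \<and> Suc k \<le> N")
      case True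
      then show ?thesis
        using nn_integral_tilted_next[of k N ?f \<phi>] f by (simp add: c_def \<gamma>_def)
    next
      case False
      then show ?thesis
        using f' by (auto simp: c_def nn_integral_cmult)
    qed
    finally show ?thesis
      by (simp add: h_def)
  qed
  have c_int: "(\<integral>\<^sup>+u. c u \<partial>fresh) = ennreal m * \<gamma> + ennreal (1 - m) * \<phi> 0"
  proof -
    have "(\<integral>\<^sup>+\<omega>. c (True, \<omega> 1) \<partial>tilted 1) = \<gamma>"
      using T1.emeasure_space_1 by (cases "Suc k \<le> N") (simp_all add: c_def \<gamma>_def evec_def)
    moreover have "(\<integral>\<^sup>+\<omega>. c (False, \<omega> 1) \<partial>tilted 1) = \<phi> 0"
      using T1.emeasure_space_1 by (simp add: c_def)
    ultimately show ?thesis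
      by (simp add: nn_integral_fresh[OF c])
  qed
  have h_int: "(\<integral>\<^sup>+\<eta>. h (restrict \<eta> {1..k}) \<partial>fresh_path) = emeasure (killed N) B"
  proof -
    have "emeasure (killed N) B = (\<integral>\<^sup>+\<omega>. indicator B \<omega> \<partial>killed N)"
      using B_path by (simp add: sets_killed)
    also have "\<dots> = (\<integral>\<^sup>+\<eta>. \<integral>\<^sup>+\<omega>. indicator B (splice_path N {1..} \<eta> \<omega>) \<partial>tilted N \<partial>fresh_path)"
      using B_path by (intro nn_integral_killed) auto
    also have "\<dots> = (\<integral>\<^sup>+\<eta>. h (restrict \<eta> {1..k}) \<partial>fresh_path)"
      unfolding h_def by (intro nn_integral_cong) (simp only: ind space_tilted)
    finally show ?thesis ..
  qed
  have "(\<lambda>\<omega>. \<phi> (evec (Suc k) \<omega>) * indicator B \<omega>) \<in> borel_measurable (path_space S)"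
    by (intro borel_measurable_times_ennreal measurable_compose[OF measurable_evec_path \<phi>] borel_measurable_indicator B_path) simp
  then have "(\<integral>\<^sup>+\<omega>. \<phi> (evec (Suc k) \<omega>) * indicator B \<omega> \<partial>killed N) =
      (\<integral>\<^sup>+\<eta>. \<integral>\<^sup>+\<omega>. \<phi> (evec (Suc k) (splice_path N {1..} \<eta> \<omega>)) * indicator B (splice_path N {1..} \<eta> \<omega>)
        \<partial>tilted N \<partial>fresh_path)"
    by (rule nn_integral_killed)
  also have "\<dots> = (\<integral>\<^sup>+\<eta>. c (\<eta> (Suc k)) * h (restrict \<eta> {1..k}) \<partial>fresh_path)"
    by (intro nn_integral_cong inner)
  also have "\<dots> = (\<integral>\<^sup>+u. c u \<partial>fresh) * (\<integral>\<^sup>+\<eta>. h (restrict \<eta> {1..k}) \<partial>fresh_path)"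
    by (rule nn_integral_fresh_path_next[OF c h])
  finally show ?thesis
    unfolding c_int h_int \<gamma>_def .
qed

lemma iid_dist_killed: "iid_dist S (killed N)"
proof (rule iid_distI[OF prob_space_killed sets_killed])
  fix k and A :: "(real^'d) set" and B :: "('d, 'b) path set"
  assume A: "A \<in> sets borel" and B: "B \<in> sets (obs_filtration S k)"
  have "evec (Suc k) -` A \<inter> space (killed N) \<in> sets (killed N)"
    using measurable_sets[OF measurable_evec_path A, of "Suc k" S] by (simp add: sets_killed space_killed)
  moreover have "B \<in> sets (killed N)"
    using B subalgebra_obs_filtration[of S k] by (auto simp: subalgebra_def sets_killed)
  ultimately have "emeasure (killed N) (evec (Suc k) -` A \<inter> space (killed N) \<inter> B) =
      (\<integral>\<^sup>+\<omega>. indicator (evec (Suc k) -` A \<inter> space (killed N) \<inter> B) \<omega> \<partial>killed N)"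
    by (intro nn_integral_indicator[symmetric]) (rule sets.Int)
  also have "\<dots> = (\<integral>\<^sup>+\<omega>. indicator A (evec (Suc k) \<omega>) * indicator B \<omega> \<partial>killed N)"
    by (intro nn_integral_cong) (simp add: indicator_def)
  also have "\<dots> = (ennreal m * (\<integral>\<^sup>+\<omega>. indicator A (evec 1 \<omega>) \<partial>tilted 1) + ennreal (1 - m) * indicator A 0) * emeasure (killed N) B"
    using A by (intro nn_integral_killed_next[OF B]) simp
  finally show "emeasure (killed N) (evec (Suc k) -` A \<inter> space (killed N) \<inter> B) =
      (ennreal m * (\<integral>\<^sup>+\<omega>. indicator A (evec 1 \<omega>) \<partial>tilted 1) + ennreal (1 - m) * indicator A 0) * emeasure (killed N) B" .
qed

lemma nn_integral_killed_first:
  assumes \<phi>: "\<phi> \<in> borel_measurable borel" "\<phi> 0 = 0"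
  shows "(\<integral>\<^sup>+\<omega>. \<phi> (evec 1 \<omega>) \<partial>killed N) = (\<integral>\<^sup>+\<omega>. \<phi> (evec 1 \<omega>) * g (evec 1 \<omega>) \<partial>Q)"
proof -
  interpret P: prob_space "killed N"
    by (rule prob_space_killed)
  have "(\<integral>\<^sup>+\<omega>. \<phi> (evec 1 \<omega>) \<partial>killed N) = (\<integral>\<^sup>+\<omega>. \<phi> (evec (Suc 0) \<omega>) * indicator (space (path_space S)) \<omega> \<partial>killed N)"
    by (intro nn_integral_cong) (simp add: space_killed)
  also have "\<dots> = ennreal m * (\<integral>\<^sup>+\<omega>. \<phi> (evec 1 \<omega>) \<partial>tilted 1)"
    using sets.top[of "obs_filtration S 0"] P.emeasure_space_1
    by (subst nn_integral_killed_next[OF _ \<phi>(1)]) (simp_all add: \<phi>(2) space_killed)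
  also have "(\<integral>\<^sup>+\<omega>. \<phi> (evec 1 \<omega>) \<partial>tilted 1) = ennreal (1 / m ^ 1) * (\<integral>\<^sup>+\<omega>. \<phi> (evec 1 \<omega>) * likelihood 1 \<omega> \<partial>Q)"
    by (rule nn_integral_tilted, rule order_refl,
        rule measurable_compose[OF measurable_evec_filtration \<phi>(1)]) simp_all
  also have "ennreal m * \<dots> = (\<integral>\<^sup>+\<omega>. \<phi> (evec 1 \<omega>) * g (evec 1 \<omega>) \<partial>Q)"
    using m_pos by (simp add: likelihood_def mult.assoc[symmetric] ennreal_mult[symmetric])
  finally show ?thesis .
qed

text \<open>
  If the first \<open>n\<close> coins show survival, the first \<open>n\<close> observations are those of the tilted path. This
  event has probability \<open>m\<^sup>n\<close>, which is just the normalisation of the density up to time \<open>n\<close>.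
\<close>

lemma nn_integral_likelihood_le_killed:
  assumes n: "n \<le> N" and f: "f \<in> borel_measurable (obs_filtration S n)"
  shows "(\<integral>\<^sup>+\<omega>. f \<omega> * likelihood n \<omega> \<partial>Q) \<le> (\<integral>\<^sup>+\<omega>. f \<omega> \<partial>killed N)"
proof -
  define G where "G = {\<eta> \<in> space fresh_path. \<forall>i\<in>{1..n}. \<eta> i \<in> {True} \<times> space (obs S)}"
  have "{True} \<times> space (obs S) \<in> sets fresh"
    unfolding sets_fresh by (intro pair_measureI) auto
  then have G_meas: "G \<in> sets fresh_path" and G_emeasure: "emeasure fresh_path G = (\<Prod>i\<in>{1..n}. emeasure fresh ({True} \<times> space (obs S)))"
    using fresh.emeasure_PiM_Collect[of "{1..n}" "\<lambda>_. {True} \<times> space (obs S)"]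
    unfolding G_def fresh_path_def by auto
  have "emeasure fresh ({True} \<times> space (obs S)) = (\<integral>\<^sup>+u. indicator ({True} \<times> space (obs S)) u \<partial>fresh)"
    using \<open>{True} \<times> space (obs S) \<in> sets fresh\<close> by simp
  also have "\<dots> = ennreal m * (\<integral>\<^sup>+\<omega>. indicator ({True} \<times> space (obs S)) (True, \<omega> 1) \<partial>tilted 1)
      + ennreal (1 - m) * (\<integral>\<^sup>+\<omega>. indicator ({True} \<times> space (obs S)) (False, \<omega> 1) \<partial>tilted 1)"
    using \<open>{True} \<times> space (obs S) \<in> sets fresh\<close> by (intro nn_integral_fresh) simp
  also have "(\<integral>\<^sup>+\<omega>. indicator ({True} \<times> space (obs S)) (True, \<omega> 1) \<partial>tilted 1) = (\<integral>\<^sup>+\<omega>. 1 \<partial>tilted 1)"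
    using measurable_space[OF measurable_coord_path[OF order_refl]]
    by (intro nn_integral_cong) (auto simp: space_tilted indicator_def)
  also have "(\<integral>\<^sup>+\<omega>. 1 \<partial>tilted 1) = 1"
    using prob_space.emeasure_space_1[OF prob_space_tilted[of 1]] by simp
  finally have G_eq: "emeasure fresh_path G = ennreal (m ^ n)"
    unfolding G_emeasure using m_pos by (simp add: indicator_def ennreal_power)
  have "(\<integral>\<^sup>+\<omega>. f \<omega> * likelihood n \<omega> \<partial>Q) = ennreal (m ^ n) * (ennreal (1 / m ^ n) * (\<integral>\<^sup>+\<omega>. f \<omega> * likelihood n \<omega> \<partial>Q))"
    using m_pos by (simp add: mult.assoc[symmetric] ennreal_mult[symmetric])
  also have "\<dots> = (\<integral>\<^sup>+\<omega>. f \<omega> \<partial>tilted N) * emeasure fresh_path G"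
    unfolding nn_integral_tilted[OF n f, symmetric] G_eq by (rule mult.commute)
  also have "\<dots> = (\<integral>\<^sup>+\<eta>. (\<integral>\<^sup>+\<omega>. f \<omega> \<partial>tilted N) * indicator G \<eta> \<partial>fresh_path)"
    by (rule nn_integral_cmult_indicator[symmetric, OF G_meas])
  also have "\<dots> \<le> (\<integral>\<^sup>+\<eta>. \<integral>\<^sup>+\<omega>. f (splice_path N {1..} \<eta> \<omega>) \<partial>tilted N \<partial>fresh_path)"
  proof (rule nn_integral_mono)
    fix \<eta> assume \<eta>: "\<eta> \<in> space fresh_path"
    show "(\<integral>\<^sup>+\<omega>. f \<omega> \<partial>tilted N) * indicator G \<eta> \<le> (\<integral>\<^sup>+\<omega>. f (splice_path N {1..} \<eta> \<omega>) \<partial>tilted N)"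
    proof (cases "\<eta> \<in> G")
      case True
      have "f \<omega> = f (splice_path N {1..} \<eta> \<omega>)" if "\<omega> \<in> space (path_space S)" for \<omega>
        using that splice_path_in_space[OF \<eta> that] True n
        by (intro filtration_measurable_eq[OF f]) (auto simp: splice_path_def splice_obs_def G_def mem_Times_iff)
      then have "(\<integral>\<^sup>+\<omega>. f \<omega> \<partial>tilted N) = (\<integral>\<^sup>+\<omega>. f (splice_path N {1..} \<eta> \<omega>) \<partial>tilted N)"
        by (intro nn_integral_cong) (simp add: space_tilted)
      then show ?thesis using True by simp
    qed simp
  qed
  also have "\<dots> = (\<integral>\<^sup>+\<omega>. f \<omega> \<partial>killed N)"
    by (rule nn_integral_killed[symmetric, OF measurable_filtration_path[OF f]])
  finally show ?thesis .
qed

lemma ex_null_dist_dominating: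
  assumes means: "\<And>j. (\<integral>\<^sup>+\<omega>. ennreal (evec 1 \<omega> $ j) * g (evec 1 \<omega>) \<partial>Q) \<le> 1"
  obtains P where "P \<in> null_dists S"
    "\<And>n f. n \<le> N \<Longrightarrow> f \<in> borel_measurable (obs_filtration S n) \<Longrightarrow>
      (\<integral>\<^sup>+\<omega>. f \<omega> * likelihood n \<omega> \<partial>Q) \<le> (\<integral>\<^sup>+\<omega>. f \<omega> \<partial>P)"
proof
  have "(\<integral>\<^sup>+\<omega>. ennreal (evec 1 \<omega> $ j) \<partial>killed N) \<le> 1" for j
    using means[of j] by (subst nn_integral_killed_first) auto
  then show "killed N \<in> null_dists S"
    by (simp add: null_dists_def iid_dist_killed)
qed (rule nn_integral_likelihood_le_killed)

end

section \<open>The rejection time and stopped processes\<close>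

lemma rejection_time_gt_iff:
  "enat t < rejection_time W \<alpha> \<omega> \<longleftrightarrow> (\<forall>n\<in>{1..t}. W n \<omega> < 1 / \<alpha>)"
proof (intro iffI ballI)
  fix n assume gt: "enat t < rejection_time W \<alpha> \<omega>" and n: "n \<in> {1..t}"
  show "W n \<omega> < 1 / \<alpha>"
  proof (rule ccontr)
    assume "\<not> W n \<omega> < 1 / \<alpha>"
    then have "rejection_time W \<alpha> \<omega> \<le> enat n"
      unfolding rejection_time_def using n by (intro Inf_lower) auto
    also have "\<dots> \<le> enat t"
      using n by simp
    finally show False
      using gt by simp
  qed
next
  assume run: "\<forall>n\<in>{1..t}. W n \<omega> < 1 / \<alpha>"
  have "enat (Suc t) \<le> rejection_time W \<alpha> \<omega>"
    unfolding rejection_time_def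
  proof (rule Inf_greatest)
    fix x assume "x \<in> {enat n |n. 1 \<le> n \<and> 1 / \<alpha> \<le> W n \<omega>}"
    then obtain n where n: "x = enat n" "1 \<le> n" "1 / \<alpha> \<le> W n \<omega>"
      by blast
    then have "n \<notin> {1..t}"
      using run by (metis not_le)
    then show "enat (Suc t) \<le> x"
      using n by simp
  qed
  then show "enat t < rejection_time W \<alpha> \<omega>"
    by (simp only: Suc_ile_eq)
qed

text \<open>
  The event that the rejection time exceeds \<open>t\<close>.
\<close>

definition running :: "'b measure \<Rightarrow> (nat \<Rightarrow> ('d::finite, 'b) path \<Rightarrow> real) \<Rightarrow> real \<Rightarrow> nat \<Rightarrow> ('d, 'b) path set" where
  "running S W \<alpha> t = {\<omega> \<in> space (path_space S). \<forall>n\<in>{1..t}. W n \<omega> < 1 / \<alpha>}"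

lemma running_0: "running S W \<alpha> 0 = space (path_space S)"
  by (simp add: running_def)

lemma running_antimono: "s \<le> t \<Longrightarrow> running S W \<alpha> t \<subseteq> running S W \<alpha> s"
  by (auto simp: running_def)

lemma running_in_filtration:
  assumes W: "nonneg_adapted S W"
  shows "running S W \<alpha> t \<in> sets (obs_filtration S t)"
proof -
  have "{\<omega> \<in> space (obs_filtration S t). W n \<omega> < 1 / \<alpha>} \<in> sets (obs_filtration S t)" if "n \<in> {1..t}" for n
  proof -
    have "W n \<in> borel_measurable (obs_filtration S t)"
      using W that by (auto simp: nonneg_adapted_def intro: measurable_filtration_mono[of "W n" S n])
    then show ?thesis by measurable
  qed
  then have "{\<omega> \<in> space (obs_filtration S t). \<forall>n\<in>{1..t}. W n \<omega> < 1 / \<alpha>} \<in> sets (obs_filtration S t)"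
    by (intro sets.sets_Collect_finite_All) auto
  then show ?thesis
    by (simp add: running_def)
qed

lemma rejection_time_measurable:
  assumes W: "nonneg_adapted S W"
  shows "rejection_time W \<alpha> \<in> measurable (path_space S) (count_space UNIV)"
proof -
  have gt: "{\<omega> \<in> space (path_space S). enat t < rejection_time W \<alpha> \<omega>} \<in> sets (path_space S)" for t
    using running_in_filtration[OF W, of \<alpha> t] subalgebra_obs_filtration[of S t]
    unfolding rejection_time_gt_iff running_def[symmetric] by (auto simp: subalgebra_def)
  have ge: "{\<omega> \<in> space (path_space S). enat t \<le> rejection_time W \<alpha> \<omega>} \<in> sets (path_space S)" for t
  proof (cases t)
    case 0
    have "enat 0 \<le> y" for y
      unfolding zero_enat_def[symmetric] by simp
    then show ?thesis
      unfolding 0 by simp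
  next
    case (Suc u)
    show ?thesis
      unfolding Suc Suc_ile_eq by (rule gt)
  qed
  have "rejection_time W \<alpha> -` {x} \<inter> space (path_space S) \<in> sets (path_space S)" for x
  proof (cases x)
    case (enat n)
    have "y = enat n \<longleftrightarrow> enat n \<le> y \<and> \<not> enat n < y" for y
      by auto
    then have "rejection_time W \<alpha> -` {x} \<inter> space (path_space S) =
        {\<omega> \<in> space (path_space S). enat n \<le> rejection_time W \<alpha> \<omega>} - {\<omega> \<in> space (path_space S). enat n < rejection_time W \<alpha> \<omega>}"
      unfolding enat by blast
    then show ?thesis
      using sets.Diff[OF ge[of n] gt[of n]] by simp
  next
    case infinity
    have "y = \<infinity> \<longleftrightarrow> (\<forall>n. enat n < y)" for y
      by (cases y) auto
    then have "rejection_time W \<alpha> -` {x} \<inter> space (path_space S) =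
        (\<Inter>n. {\<omega> \<in> space (path_space S). enat n < rejection_time W \<alpha> \<omega>})"
      unfolding infinity by blast
    then show ?thesis
      using sets.countable_INT'[of UNIV "\<lambda>n. {\<omega> \<in> space (path_space S). enat n < rejection_time W \<alpha> \<omega>}"] gt by auto
  qed
  then show ?thesis
    by (simp add: measurable_count_space_eq2_countable)
qed

lemma expected_rejection_time:
  assumes "nonneg_adapted S W" and sets_Q: "sets Q = sets (path_space S)"
  shows "(\<integral>\<^sup>+ \<omega>. ennreal_of_enat (rejection_time W \<alpha> \<omega>) \<partial>Q) = (\<Sum>t. emeasure Q (running S W \<alpha> t))"
proof -
  have "rejection_time W \<alpha> \<in> measurable Q (count_space UNIV)"
    using rejection_time_measurable[OF assms(1)] by (simp add: measurable_cong_sets[OF sets_Q refl])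
  then show ?thesis
    using sets_eq_imp_space_eq[OF sets_Q]
    unfolding running_def rejection_time_gt_iff[symmetric] by (simp add: nn_integral_enat_function)
qed

text \<open>
  Optional stopping for the time at which the path leaves the decreasing events \<open>A\<close>. The induction
  carries along the contribution of the paths that have not left them yet: by the supermartingale
  property this contribution can only decrease from one time to the next.
\<close>

lemma test_supermartingale_stopped_le_1:
  fixes P :: "('d::finite, 'b) path measure"
  assumes P: "prob_space P" "sets P = sets (path_space S)"
    and M: "test_supermartingale S P M"
    and A: "\<And>t. A t \<in> sets (obs_filtration S t)" "\<And>t. A (Suc t) \<subseteq> A t"
  shows "(\<Sum>n<N. \<integral>\<^sup>+\<omega>. indicator (A n - A (Suc n)) \<omega> * ennreal (M (Suc n) \<omega>) \<partial>P) \<le> 1"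
proof -
  interpret prob_space P by (rule P)
  have subalg: "subalgebra P (obs_filtration S n)" for n
    using subalgebra_obs_filtration[of S n] P(2) sets_eq_imp_space_eq[OF P(2)] by (simp add: subalgebra_def)
  have A_P[measurable]: "A t \<in> sets P" for t
    using A(1)[of t] subalg[of t] by (auto simp: subalgebra_def)
  have M_P[measurable]: "M (Suc n) \<in> borel_measurable P" for n
    using M by (intro measurable_from_subalg[OF subalg[of "Suc n"]]) (auto simp: test_supermartingale_def nonneg_adapted_def)
  have split: "(\<integral>\<^sup>+\<omega>. indicator (A n - A (Suc n)) \<omega> * ennreal (M (Suc n) \<omega>) \<partial>P) + (\<integral>\<^sup>+\<omega>. indicator (A (Suc n)) \<omega> * ennreal (M (Suc n) \<omega>) \<partial>P)
    = (\<integral>\<^sup>+\<omega>. indicator (A n) \<omega> * ennreal (M (Suc n) \<omega>) \<partial>P)" for n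
    using A(2)[of n] by (subst nn_integral_add[symmetric]) (auto intro!: nn_integral_cong simp: indicator_def)
  have decr: "(\<integral>\<^sup>+\<omega>. indicator (A (Suc n)) \<omega> * ennreal (M (Suc (Suc n)) \<omega>) \<partial>P) \<le> (\<integral>\<^sup>+\<omega>. indicator (A (Suc n)) \<omega> * ennreal (M (Suc n) \<omega>) \<partial>P)" for n
  proof -
    interpret F: finite_measure_subalgebra P "obs_filtration S (Suc n)"
      by unfold_locales (rule subalg)
    have "AE \<omega> in P. nn_cond_exp P (obs_filtration S (Suc (Suc n) - 1)) (\<lambda>\<omega>. ennreal (M (Suc (Suc n)) \<omega>)) \<omega> \<le> ennreal (M (Suc (Suc n) - 1) \<omega>)"
      using M[unfolded test_supermartingale_def, THEN conjunct2, THEN conjunct2, THEN spec, of "Suc (Suc n)"]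
      by (rule mp) simp
    then have ae: "AE \<omega> in P. nn_cond_exp P (obs_filtration S (Suc n)) (\<lambda>\<omega>. ennreal (M (Suc (Suc n)) \<omega>)) \<omega> \<le> ennreal (M (Suc n) \<omega>)"
      by simp
    have "(\<integral>\<^sup>+\<omega>. indicator (A (Suc n)) \<omega> * ennreal (M (Suc (Suc n)) \<omega>) \<partial>P) =
        (\<integral>\<^sup>+\<omega>. indicator (A (Suc n)) \<omega> * nn_cond_exp P (obs_filtration S (Suc n)) (\<lambda>\<omega>. ennreal (M (Suc (Suc n)) \<omega>)) \<omega> \<partial>P)"
      using A(1)[of "Suc n"] by (intro F.nn_cond_exp_intg[symmetric]) auto
    also have "\<dots> \<le> (\<integral>\<^sup>+\<omega>. indicator (A (Suc n)) \<omega> * ennreal (M (Suc n) \<omega>) \<partial>P)"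
      using ae by (intro nn_integral_mono_AE) (auto elim!: eventually_mono intro!: mult_left_mono)
    finally show ?thesis .
  qed
  let ?D = "\<lambda>n. \<integral>\<^sup>+\<omega>. indicator (A n - A (Suc n)) \<omega> * ennreal (M (Suc n) \<omega>) \<partial>P"
  have "(\<Sum>n<Suc N. ?D n) + (\<integral>\<^sup>+\<omega>. indicator (A (Suc N)) \<omega> * ennreal (M (Suc N) \<omega>) \<partial>P) \<le> 1" for N
  proof (induction N)
    case 0
    have "(\<integral>\<^sup>+\<omega>. indicator (A 0) \<omega> * ennreal (M (Suc 0) \<omega>) \<partial>P) \<le> (\<integral>\<^sup>+\<omega>. ennreal (M 1 \<omega>) \<partial>P)"
      by (intro nn_integral_mono) (simp add: indicator_def)
    also have "\<dots> \<le> 1"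
      using M by (simp add: test_supermartingale_def)
    finally show ?case
      by (simp add: split)
  next
    case (Suc N)
    have "(\<Sum>n<Suc (Suc N). ?D n) + (\<integral>\<^sup>+\<omega>. indicator (A (Suc (Suc N))) \<omega> * ennreal (M (Suc (Suc N)) \<omega>) \<partial>P) =
        (\<Sum>n<Suc N. ?D n) + (\<integral>\<^sup>+\<omega>. indicator (A (Suc N)) \<omega> * ennreal (M (Suc (Suc N)) \<omega>) \<partial>P)"
      unfolding split[symmetric] by (simp add: add.assoc)
    also have "\<dots> \<le> (\<Sum>n<Suc N. ?D n) + (\<integral>\<^sup>+\<omega>. indicator (A (Suc N)) \<omega> * ennreal (M (Suc N) \<omega>) \<partial>P)"
      by (intro add_left_mono decr)
    also have "\<dots> \<le> 1"
      by (rule Suc.IH)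
    finally show ?case .
  qed
  from this[of N] have "(\<Sum>n<Suc N. ?D n) \<le> 1"
    by (rule order_trans[rotated]) simp
  then show ?thesis
    by (rule order_trans[rotated]) (auto intro!: sum_mono2)
qed

text \<open>
  Wald's identity for the time at which the path leaves the events \<open>A\<close>, truncated at \<open>N\<close>: the event
  \<open>A t\<close> that the step \<open>Suc t\<close> is still made belongs to the past of that step.
\<close>

lemma wald_identity_truncated:
  fixes Q :: "('d::finite, 'b) path measure" and \<phi> :: "real^'d \<Rightarrow> real"
  assumes iid: "iid_dist S Q" and \<phi>: "\<phi> \<in> borel_measurable borel" "integrable Q (\<lambda>\<omega>. \<phi> (evec 1 \<omega>))"
    and A: "\<And>t. A t \<in> sets (obs_filtration S t)"
  shows "integrable Q (\<lambda>\<omega>. \<Sum>t<N. indicator (A t) \<omega> * \<phi> (evec (Suc t) \<omega>))"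
    and "(\<integral>\<omega>. (\<Sum>t<N. indicator (A t) \<omega> * \<phi> (evec (Suc t) \<omega>)) \<partial>Q) = (\<integral>\<omega>. \<phi> (evec 1 \<omega>) \<partial>Q) * (\<Sum>t<N. measure Q (A t))"
proof -
  interpret prob_space Q
    using iid by (simp add: iid_dist_def)
  have sets_Q: "sets Q = sets (path_space S)"
    using iid by (simp add: iid_dist_def)
  note space_Q = sets_eq_imp_space_eq[OF sets_Q]
  have evec_Q: "evec (Suc t) \<in> borel_measurable Q" for t
    using measurable_evec_path[of "Suc t" S] by (simp add: measurable_cong_sets[OF sets_Q refl])
  have A_Q: "A t \<in> sets Q" for t
    using A[of t] subalgebra_obs_filtration[of S t] sets_Q by (auto simp: subalgebra_def)
  have step: "integrable Q (\<lambda>\<omega>. indicator (A t) \<omega> * \<phi> (evec (Suc t) \<omega>)) \<and>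
    (\<integral>\<omega>. indicator (A t) \<omega> * \<phi> (evec (Suc t) \<omega>) \<partial>Q) = measure Q (A t) * (\<integral>\<omega>. \<phi> (evec 1 \<omega>) \<partial>Q)" for t
  proof -
    have eq: "distr Q borel (evec (Suc t)) = distr Q borel (evec 1)"
      using iid unfolding iid_dist_def by (metis le_add1 plus_1_eq_Suc)
    have "integrable (distr Q borel (evec (Suc t))) \<phi>"
      unfolding eq using \<phi> evec_Q[of 0] by (subst integrable_distr_eq) auto
    then have int: "integrable Q (\<lambda>\<omega>. \<phi> (evec (Suc t) \<omega>))"
      using \<phi>(1) evec_Q by (subst (asm) integrable_distr_eq) auto
    have "(\<integral>\<omega>. \<phi> (evec (Suc t) \<omega>) \<partial>Q) = (\<integral>x. \<phi> x \<partial>distr Q borel (evec (Suc t)))"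
      using \<phi>(1) evec_Q by (intro integral_distr[symmetric]) auto
    also have "\<dots> = (\<integral>\<omega>. \<phi> (evec 1 \<omega>) \<partial>Q)"
      unfolding eq using \<phi>(1) evec_Q[of 0] by (intro integral_distr) auto
    finally have mean: "(\<integral>\<omega>. \<phi> (evec (Suc t) \<omega>) \<partial>Q) = (\<integral>\<omega>. \<phi> (evec 1 \<omega>) \<partial>Q)" .
    have "indep_set (sets (vimage_algebra (space (path_space S)) (evec (Suc t)) borel)) (sets (obs_filtration S (Suc t - 1)))"
      using iid unfolding iid_dist_def by (metis le_add1 plus_1_eq_Suc)
    then have ind: "indep_set (sets (vimage_algebra (space (path_space S)) (evec (Suc t)) borel)) (sets (obs_filtration S t))"
      by simp
    have "evec (Suc t) \<in> borel_measurable (vimage_algebra (space (path_space S)) (evec (Suc t)) borel)"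
      by (rule measurable_vimage_algebra1) simp
    from measurable_compose[OF this \<phi>(1)] borel_measurable_indicator[OF A[of t]]
    have "indep_var borel (\<lambda>\<omega>. \<phi> (evec (Suc t) \<omega>)) borel (indicator (A t) :: _ \<Rightarrow> real)"
      by (rule indep_var_of_indep_set[OF ind, rotated 2]) (simp_all only: space_Q space_vimage_algebra space_obs_filtration)
    moreover have "integrable Q (indicator (A t) :: _ \<Rightarrow> real)"
      using A_Q[of t] by (simp add: less_top[symmetric])
    ultimately show ?thesis
      using indep_var_integrable[OF _ int] indep_var_lebesgue_integral[OF _ int] A_Q[of t]
      by (simp add: mean mult.commute)
  qed
  then show "integrable Q (\<lambda>\<omega>. \<Sum>t<N. indicator (A t) \<omega> * \<phi> (evec (Suc t) \<omega>))"
    by (intro Bochner_Integration.integrable_sum) blast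
  show "(\<integral>\<omega>. (\<Sum>t<N. indicator (A t) \<omega> * \<phi> (evec (Suc t) \<omega>)) \<partial>Q) = (\<integral>\<omega>. \<phi> (evec 1 \<omega>) \<partial>Q) * (\<Sum>t<N. measure Q (A t))"
    using step by (subst Bochner_Integration.integral_sum) (auto simp: sum_distrib_left mult.commute)
qed

text \<open>
  The sum in Wald's identity is pathwise a stopped sum. Here \<open>k\<close> is the minimum of \<open>N\<close> and the first time at
  which \<open>\<omega>\<close> is outside \<open>A\<close>; the same \<open>k\<close> serves all summands \<open>y\<close>.
\<close>

lemma stopped_sum_eq:
  fixes A :: "nat \<Rightarrow> 'a set"
  assumes A: "\<And>t. A (Suc t) \<subseteq> A t"
  obtains k where "k \<le> N" "\<And>t. t < k \<Longrightarrow> \<omega> \<in> A t" "k < N \<Longrightarrow> \<omega> \<notin> A k"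
    "\<And>y :: nat \<Rightarrow> real. (\<Sum>t<N. indicator (A t) \<omega> * y (Suc t)) = (\<Sum>i\<in>{1..k}. y i)"
proof -
  have anti: "\<omega> \<in> A t \<Longrightarrow> s \<le> t \<Longrightarrow> \<omega> \<in> A s" for s t
    using lift_Suc_antimono_le[of A s t] A by blast
  define k where "k = (LEAST k. k = N \<or> \<omega> \<notin> A k)"
  have k: "k = N \<or> \<omega> \<notin> A k" and le: "k \<le> N"
    unfolding k_def by (rule LeastI[of _ N], simp) (rule Least_le, simp)
  have before: "\<omega> \<in> A t" if "t < k" for t
    using not_less_Least[of t "\<lambda>k. k = N \<or> \<omega> \<notin> A k"] that by (auto simp: k_def)
  have eq: "(\<Sum>t<N. indicator (A t) \<omega> * y (Suc t)) = (\<Sum>i\<in>{1..k}. y i)" for y :: "nat \<Rightarrow> real"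
  proof -
    have "(\<Sum>t<N. indicator (A t) \<omega> * y (Suc t)) = (\<Sum>t<k. indicator (A t) \<omega> * y (Suc t))"
    proof (rule sum.mono_neutral_right)
      show "\<forall>t\<in>{..<N} - {..<k}. indicator (A t) \<omega> * y (Suc t) = 0"
        using k anti by (auto simp: indicator_def)
    qed (use le in auto)
    also have "\<dots> = (\<Sum>t<k. y (Suc t))"
      using before by (intro sum.cong) auto
    also have "\<dots> = (\<Sum>i\<in>{1..k}. y i)"
      by (simp add: sum.atLeast1_atMost_eq)
    finally show ?thesis .
  qed
  from that[OF le before _ eq] k show ?thesis
    by auto
qed

section \<open>Bounds on the expected rejection time\<close>

locale log_optimal_portfolio =
  fixes S :: "'b measure" and Q :: "('d::finite, 'b) path measure" and lam :: "real^'d" and l :: real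
  assumes iid: "iid_dist S Q" and optimal: "log_optimal Q lam"
    and growth: "expected_log Q (\<lambda>\<omega>. lam \<bullet> evec 1 \<omega>) = ereal l"
    and cash: "cash_superfluous Q lam"
begin

sublocale prob_space Q
  using iid by (simp add: iid_dist_def)

lemma sets_Q: "sets Q = sets (path_space S)"
  using iid by (simp add: iid_dist_def)

lemma space_Q: "space Q = space (path_space S)"
  by (rule sets_eq_imp_space_eq[OF sets_Q])

lemma measurable_evec: "1 \<le> i \<Longrightarrow> evec i \<in> borel_measurable Q"
  using measurable_evec_path[of i S] by (simp add: measurable_cong_sets[OF sets_Q refl])

lemma lam_simplex: "lam \<in> weight_simplex"
  using optimal by (simp add: log_optimal_def is_arg_max_def)

lemma wealth_nonneg: "\<omega> \<in> space (path_space S) \<Longrightarrow> 1 \<le> i \<Longrightarrow> 0 \<le> lam \<bullet> evec i \<omega>"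
  using lam_simplex by (auto simp: inner_vec_def weight_simplex_def intro!: sum_nonneg mult_nonneg_nonneg evec_nonneg)

lemma measurable_wealth: "1 \<le> i \<Longrightarrow> (\<lambda>\<omega>. lam \<bullet> evec i \<omega>) \<in> borel_measurable Q"
  using measurable_evec by (intro borel_measurable_inner) auto

lemma first_wealth_pos: "AE \<omega> in Q. 0 < lam \<bullet> evec 1 \<omega>"
  and integrable_log_wealth: "integrable Q (\<lambda>\<omega>. ln (lam \<bullet> evec 1 \<omega>))"
  and integral_log_wealth: "(\<integral>\<omega>. ln (lam \<bullet> evec 1 \<omega>) \<partial>Q) = l"
  using expected_log_eq_ereal[OF measurable_wealth _ growth] wealth_nonneg by (auto simp: space_Q)

lemma wealth_pos: "AE \<omega> in Q. \<forall>i\<ge>1. 0 < lam \<bullet> evec i \<omega>"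
proof -
  have "AE \<omega> in Q. 0 < lam \<bullet> evec i \<omega>" if i: "1 \<le> i" for i
  proof -
    have eq: "distr Q borel (evec i) = distr Q borel (evec 1)"
      using iid i unfolding iid_dist_def by blast
    have "AE x in distr Q borel (evec 1). 0 < lam \<bullet> x"
      using first_wealth_pos measurable_evec[of 1] by (subst AE_distr_iff) auto
    then show ?thesis
      unfolding eq[symmetric] using measurable_evec[OF i] by (subst (asm) AE_distr_iff) auto
  qed
  then show ?thesis
    by (subst AE_all_countable) auto
qed

text \<open>
  Optimality is used along the segments from \<open>lam\<close> to the vertices of the simplex.
\<close>

lemma coordinate_ratio_le_1: "(\<integral>\<^sup>+\<omega>. ennreal (evec 1 \<omega> $ j / (lam \<bullet> evec 1 \<omega>)) \<partial>Q) \<le> 1"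
proof (rule log_optimal_ratio_le_one[OF measurable_wealth])
  show "(\<lambda>\<omega>. evec 1 \<omega> $ j) \<in> borel_measurable Q"
    by (rule measurable_compose[OF measurable_evec]) simp_all
  fix k :: real assume k: "0 < k" "k < 1"
  define mu where "mu = k *\<^sub>R axis j 1 + (1 - k) *\<^sub>R lam"
  have "(\<Sum>i\<in>UNIV. mu $ i) = 1"
    using lam_simplex by (simp add: mu_def weight_simplex_def axis_def sum.distrib sum_distrib_left[symmetric])
  moreover have nonneg: "0 \<le> mu $ i" for i
    using lam_simplex k by (simp add: mu_def weight_simplex_def axis_def)
  moreover have "mu $ i \<le> (\<Sum>i\<in>UNIV. mu $ i)" for i
    by (rule member_le_sum) (use nonneg in auto)
  ultimately have "mu \<in> weight_simplex"
    by (simp add: weight_simplex_def)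
  then have "expected_log Q (\<lambda>\<omega>. mu \<bullet> evec 1 \<omega>) \<le> expected_log Q (\<lambda>\<omega>. lam \<bullet> evec 1 \<omega>)"
    using optimal by (auto simp: log_optimal_def is_arg_max_linorder)
  then show "expected_log Q (\<lambda>\<omega>. k * evec 1 \<omega> $ j + (1 - k) * (lam \<bullet> evec 1 \<omega>)) \<le> ereal l"
    by (simp add: growth[symmetric] mu_def inner_add_left inner_axis')
qed (use growth in \<open>auto simp: space_Q wealth_nonneg evec_nonneg\<close>)

lemma cash_ratio_le_1: "(\<integral>\<^sup>+\<omega>. ennreal (1 / (lam \<bullet> evec 1 \<omega>)) \<partial>Q) \<le> 1"
proof (rule log_optimal_ratio_le_one[OF measurable_wealth])
  fix k :: real assume "0 < k" "k < 1"
  then show "expected_log Q (\<lambda>\<omega>. k * 1 + (1 - k) * (lam \<bullet> evec 1 \<omega>)) \<le> ereal l"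
    using cash by (simp add: cash_superfluous_def growth[symmetric])
qed (use growth in \<open>auto simp: space_Q wealth_nonneg\<close>)

definition cash_mass :: real where
  "cash_mass = enn2real (\<integral>\<^sup>+\<omega>. ennreal (1 / (lam \<bullet> evec 1 \<omega>)) \<partial>Q)"

lemma ennreal_cash_mass: "ennreal cash_mass = (\<integral>\<^sup>+\<omega>. ennreal (1 / (lam \<bullet> evec 1 \<omega>)) \<partial>Q)"
  unfolding cash_mass_def using cash_ratio_le_1 by (intro ennreal_enn2real) (auto simp: less_top[symmetric] top_unique)

lemma cash_mass_pos: "0 < cash_mass" and cash_mass_le_1: "cash_mass \<le> 1"
proof -
  show "cash_mass \<le> 1"
    using cash_ratio_le_1 unfolding ennreal_cash_mass[symmetric] by simp
  have [measurable]: "(\<lambda>\<omega>. lam \<bullet> evec 1 \<omega>) \<in> borel_measurable Q"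
    by (rule measurable_wealth) simp
  have "(\<integral>\<^sup>+\<omega>. ennreal (1 / (lam \<bullet> evec 1 \<omega>)) \<partial>Q) \<noteq> 0"
  proof
    assume "(\<integral>\<^sup>+\<omega>. ennreal (1 / (lam \<bullet> evec 1 \<omega>)) \<partial>Q) = 0"
    moreover have "(\<lambda>\<omega>. ennreal (1 / (lam \<bullet> evec 1 \<omega>))) \<in> borel_measurable Q"
      by measurable
    ultimately have "AE \<omega> in Q. ennreal (1 / (lam \<bullet> evec 1 \<omega>)) = 0"
      by (simp only: nn_integral_0_iff_AE)
    with first_wealth_pos have "AE \<omega> in Q. False"
      by eventually_elim (simp add: ennreal_eq_0_iff field_simps)
    then show False
      by simp
  qed
  then show "0 < cash_mass"
    unfolding ennreal_cash_mass[symmetric] by (simp add: ennreal_eq_0_iff)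
qed

sublocale numeraire: iid_likelihood_ratio S Q "\<lambda>x. ennreal (1 / (lam \<bullet> x))" cash_mass
  by unfold_locales (use iid ennreal_cash_mass cash_mass_pos cash_mass_le_1 in auto)

lemma likelihood_eq:
  assumes "\<forall>i\<ge>1. 0 < lam \<bullet> evec i \<omega>"
  shows "numeraire.likelihood n \<omega> = ennreal (exp (- (\<Sum>i\<in>{1..n}. ln (lam \<bullet> evec i \<omega>))))"
proof -
  have "numeraire.likelihood n \<omega> = (\<Prod>i\<in>{1..n}. ennreal (exp (- ln (lam \<bullet> evec i \<omega>))))"
    unfolding numeraire.likelihood_def using assms by (intro prod.cong) (auto simp: exp_minus inverse_eq_divide)
  then show ?thesis
    by (simp add: prod_ennreal exp_sum sum_negf[symmetric])
qed

lemma nn_integral_likelihood_le_1: "(\<integral>\<^sup>+\<omega>. numeraire.likelihood n \<omega> \<partial>Q) \<le> 1"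
proof -
  have "(\<integral>\<^sup>+\<omega>. numeraire.likelihood n \<omega> \<partial>Q) = (\<integral>\<^sup>+\<omega>. 1 * numeraire.likelihood n \<omega> \<partial>Q)"
    by simp
  also have "\<dots> = ennreal (cash_mass ^ n)"
    by (subst numeraire.nn_integral_mult_likelihood[of 0 n]) (auto simp: emeasure_space_1)
  also have "\<dots> \<le> 1"
    using cash_mass_pos cash_mass_le_1 by (simp add: power_le_one)
  finally show ?thesis .
qed

text \<open>
  Deflated by the optimal wealth, an e-process behaves like a test supermartingale even under the
  alternative \<open>Q\<close>: on the events up to time \<open>N\<close> the deflated expectation is bounded by an expectation under
  a null distribution, to which optional stopping applies.
\<close>

lemma e_process_stopped_le_1:
  assumes W: "e_process S W"
    and A: "\<And>t. A t \<in> sets (obs_filtration S t)" "\<And>t. A (Suc t) \<subseteq> A t"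
  shows "(\<Sum>n<N. \<integral>\<^sup>+\<omega>. indicator (A n - A (Suc n)) \<omega> * ennreal (W (Suc n) \<omega>) * numeraire.likelihood (Suc n) \<omega> \<partial>Q) \<le> 1"
proof -
  have "(\<integral>\<^sup>+\<omega>. ennreal (evec 1 \<omega> $ j) * ennreal (1 / (lam \<bullet> evec 1 \<omega>)) \<partial>Q) \<le> 1" for j
  proof -
    have "(\<integral>\<^sup>+\<omega>. ennreal (evec 1 \<omega> $ j) * ennreal (1 / (lam \<bullet> evec 1 \<omega>)) \<partial>Q) =
        (\<integral>\<^sup>+\<omega>. ennreal (evec 1 \<omega> $ j / (lam \<bullet> evec 1 \<omega>)) \<partial>Q)"
      by (intro nn_integral_cong) (simp add: ennreal_mult[symmetric] space_Q wealth_nonneg evec_nonneg)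
    then show ?thesis
      using coordinate_ratio_le_1[of j] by simp
  qed
  then obtain P where P: "P \<in> null_dists S"
    and dom: "\<And>n f. n \<le> N \<Longrightarrow> f \<in> borel_measurable (obs_filtration S n) \<Longrightarrow>
      (\<integral>\<^sup>+\<omega>. f \<omega> * numeraire.likelihood n \<omega> \<partial>Q) \<le> (\<integral>\<^sup>+\<omega>. f \<omega> \<partial>P)"
    by (rule numeraire.ex_null_dist_dominating[of N]) auto
  obtain M where M: "test_supermartingale S P M" and le: "AE \<omega> in P. \<forall>n\<ge>1. W n \<omega> \<le> M n \<omega>"
    using W P unfolding e_process_def by blast
  have D: "A n - A (Suc n) \<in> sets (obs_filtration S (Suc n))" for n
    using A(1)[of n] A(1)[of "Suc n"] subalgebra_obs_filtration_mono[of n "Suc n" S] by (auto simp: subalgebra_def)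
  have W_meas: "W (Suc n) \<in> borel_measurable (obs_filtration S (Suc n))" for n
    using W by (simp add: e_process_def nonneg_adapted_def)
  have "(\<Sum>n<N. \<integral>\<^sup>+\<omega>. indicator (A n - A (Suc n)) \<omega> * ennreal (W (Suc n) \<omega>) * numeraire.likelihood (Suc n) \<omega> \<partial>Q)
      \<le> (\<Sum>n<N. \<integral>\<^sup>+\<omega>. indicator (A n - A (Suc n)) \<omega> * ennreal (W (Suc n) \<omega>) \<partial>P)"
    using D W_meas by (intro sum_mono dom) auto
  also have "\<dots> \<le> (\<Sum>n<N. \<integral>\<^sup>+\<omega>. indicator (A n - A (Suc n)) \<omega> * ennreal (M (Suc n) \<omega>) \<partial>P)"
  proof (intro sum_mono nn_integral_mono_AE)
    fix n
    show "AE \<omega> in P. indicator (A n - A (Suc n)) \<omega> * ennreal (W (Suc n) \<omega>) \<le> indicator (A n - A (Suc n)) \<omega> * ennreal (M (Suc n) \<omega>)"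
      using le by eventually_elim (intro mult_left_mono ennreal_leI, auto)
  qed
  also have "\<dots> \<le> 1"
    using P by (intro test_supermartingale_stopped_le_1[OF _ _ M A]) (auto simp: null_dists_def iid_dist_def)
  finally show ?thesis .
qed

text \<open>
  With \<open>T\<close> the log-wealth at the stopping time \<open>min \<tau> N\<close>, the inequality \<open>x + 1 \<le> exp x\<close> bounds \<open>b - T + 1\<close>
  by \<open>exp b\<close> times the likelihood at \<open>\<tau>\<close> on \<open>\<tau> \<le> N\<close>, and \<open>1 - T\<close> by the likelihood at \<open>N\<close> elsewhere. Both
  bounds have expectation at most 1, the first one because \<open>exp b \<le> W\<close> at time \<open>\<tau>\<close> and the deflated
  e-process stopped there has expectation at most 1.
\<close>

lemma expected_duration_lower_bound:
  assumes W: "e_process S W" and \<alpha>: "0 < \<alpha>"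
  shows "ln (1 / \<alpha>) * (1 - measure Q (running S W \<alpha> N)) \<le> l * (\<Sum>t<N. measure Q (running S W \<alpha> t)) + 1"
proof -
  define A where "A = running S W \<alpha>"
  define b where "b = ln (1 / \<alpha>)"
  have exp_b: "exp b = 1 / \<alpha>"
    using \<alpha> by (simp add: b_def)
  have adapted: "nonneg_adapted S W"
    using W by (simp add: e_process_def)
  have A: "A t \<in> sets (obs_filtration S t)" "A (Suc t) \<subseteq> A t" for t
    unfolding A_def by (rule running_in_filtration[OF adapted], rule running_antimono, simp)
  have A_Q[measurable]: "A t \<in> sets Q" for t
    using A(1)[of t] subalgebra_obs_filtration[of S t] sets_Q by (auto simp: subalgebra_def)
  have A_0: "A 0 = space (path_space S)"
    by (simp add: A_def running_0)
  define X where "X x = ln (lam \<bullet> x)" for x :: "real^'d"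
  have X: "X \<in> borel_measurable borel" "integrable Q (\<lambda>\<omega>. X (evec 1 \<omega>))"
  proof -
    show "X \<in> borel_measurable borel"
      unfolding X_def by measurable
    show "integrable Q (\<lambda>\<omega>. X (evec 1 \<omega>))"
      unfolding X_def using integrable_log_wealth by simp
  qed
  define T where "T \<omega> = (\<Sum>t<N. indicator (A t) \<omega> * X (evec (Suc t) \<omega>))" for \<omega>
  have T: "integrable Q T" "(\<integral>\<omega>. T \<omega> \<partial>Q) = l * (\<Sum>t<N. measure Q (A t))"
    unfolding T_def using wald_identity_truncated[OF iid X A(1)] integral_log_wealth by (auto simp: X_def)
  \<comment> \<open>\<open>f\<close> is the left-hand side of the pathwise inequality, \<open>G\<close> the right-hand side, whose summands belong to
  the events \<open>\<tau> = Suc n\<close>; the last term of \<open>G\<close> takes care of the paths with \<open>\<tau> > N\<close>.\<close>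
  define f where "f \<omega> = b * (1 - indicator (A N) \<omega>) - T \<omega> + 1" for \<omega>
  define G where "G \<omega> = (\<Sum>n<N. indicator (A n - A (Suc n)) \<omega> * ennreal (exp b) * numeraire.likelihood (Suc n) \<omega>) + numeraire.likelihood N \<omega>" for \<omega>
  have lik_meas[measurable]: "numeraire.likelihood n \<in> borel_measurable Q" for n
    by (rule numeraire.measurable_likelihood_Q)
  have int_f: "integrable Q f"
    unfolding f_def using T(1)
    by (intro Bochner_Integration.integrable_add Bochner_Integration.integrable_diff integrable_mult_right)
       (auto simp: less_top[symmetric])
  have f_le: "AE \<omega> in Q. ennreal (f \<omega>) \<le> G \<omega>"
    using wealth_pos AE_space
  proof eventually_elim
    case (elim \<omega>)
    obtain k where k: "k \<le> N" "\<And>t. t < k \<Longrightarrow> \<omega> \<in> A t" "k < N \<Longrightarrow> \<omega> \<notin> A k"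
      and sum: "\<And>y :: nat \<Rightarrow> real. (\<Sum>t<N. indicator (A t) \<omega> * y (Suc t)) = (\<Sum>i\<in>{1..k}. y i)"
      using stopped_sum_eq[of A N \<omega>, OF A(2)] by blast
    have T_eq: "T \<omega> = (\<Sum>i\<in>{1..k}. ln (lam \<bullet> evec i \<omega>))"
      unfolding T_def X_def by (rule sum)
    show ?case
    proof (cases "k = N \<and> \<omega> \<in> A N")
      case True
      have "f \<omega> \<le> exp (- T \<omega>)"
        using exp_ge_add_one_self[of "- T \<omega>"] True by (simp add: f_def)
      then have "ennreal (f \<omega>) \<le> numeraire.likelihood N \<omega>"
        unfolding likelihood_eq[OF elim(1)] using True T_eq by (simp add: ennreal_leI)
      then show ?thesis
        unfolding G_def by (rule order_trans) simp
    next
      case False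
      then have notin: "\<omega> \<notin> A k"
        using k(1,3) by (cases "k = N") auto
      then have "k \<noteq> 0"
        using A_0 elim(2) by (metis space_Q)
      then obtain n where n: "k = Suc n"
        by (cases k) auto
      have "\<omega> \<notin> A N"
        using notin lift_Suc_antimono_le[of A k N] A(2) k(1) by blast
      then have "f \<omega> = 1 + (b - T \<omega>)"
        by (simp add: f_def)
      also have "\<dots> \<le> exp (b - T \<omega>)"
        by (rule exp_ge_add_one_self)
      finally have "f \<omega> \<le> exp (b - T \<omega>)" .
      then have "ennreal (f \<omega>) \<le> ennreal (exp b) * numeraire.likelihood (Suc n) \<omega>"
        unfolding likelihood_eq[OF elim(1)] T_eq n[symmetric]
        by (simp add: ennreal_mult[symmetric] exp_add[symmetric] ennreal_leI)
      also have "\<dots> = indicator (A n - A (Suc n)) \<omega> * ennreal (exp b) * numeraire.likelihood (Suc n) \<omega>"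
        using k(2)[of n] notin n by simp
      also have "\<dots> \<le> (\<Sum>n<N. indicator (A n - A (Suc n)) \<omega> * ennreal (exp b) * numeraire.likelihood (Suc n) \<omega>)"
        using k(1) n by (intro member_le_sum) auto
      also have "\<dots> \<le> G \<omega>"
        unfolding G_def by simp
      finally show ?thesis .
    qed
  qed
  have "(\<integral>\<^sup>+\<omega>. ennreal (f \<omega>) \<partial>Q) \<le> (\<integral>\<^sup>+\<omega>. G \<omega> \<partial>Q)"
    by (rule nn_integral_mono_AE[OF f_le])
  also have "\<dots> = (\<Sum>n<N. \<integral>\<^sup>+\<omega>. indicator (A n - A (Suc n)) \<omega> * ennreal (exp b) * numeraire.likelihood (Suc n) \<omega> \<partial>Q)
      + (\<integral>\<^sup>+\<omega>. numeraire.likelihood N \<omega> \<partial>Q)"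
    unfolding G_def by (subst nn_integral_add) (auto simp: nn_integral_sum)
  also have "\<dots> \<le> (\<Sum>n<N. \<integral>\<^sup>+\<omega>. indicator (A n - A (Suc n)) \<omega> * ennreal (W (Suc n) \<omega>) * numeraire.likelihood (Suc n) \<omega> \<partial>Q)
      + (\<integral>\<^sup>+\<omega>. numeraire.likelihood N \<omega> \<partial>Q)"
  proof (intro add_right_mono sum_mono nn_integral_mono mult_right_mono)
    fix n \<omega>
    have "1 / \<alpha> \<le> W (Suc n) \<omega>" if "\<omega> \<in> A n - A (Suc n)"
      using that by (auto simp: A_def running_def atLeastAtMostSuc_conv)
    then show "indicator (A n - A (Suc n)) \<omega> * ennreal (exp b) \<le> indicator (A n - A (Suc n)) \<omega> * ennreal (W (Suc n) \<omega>)"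
      unfolding exp_b by (cases "\<omega> \<in> A n - A (Suc n)") (auto intro: ennreal_leI)
  qed simp
  also have "\<dots> \<le> 1 + 1"
    by (intro add_mono e_process_stopped_le_1[OF W A] nn_integral_likelihood_le_1)
  finally have "(\<integral>\<^sup>+\<omega>. ennreal (f \<omega>) \<partial>Q) \<le> 2"
    by simp
  then have "enn2real (\<integral>\<^sup>+\<omega>. ennreal (f \<omega>) \<partial>Q) \<le> 2"
    by (intro enn2real_leI) auto
  moreover have "(\<integral>\<omega>. f \<omega> \<partial>Q) \<le> enn2real (\<integral>\<^sup>+\<omega>. ennreal (f \<omega>) \<partial>Q)"
    unfolding real_lebesgue_integral_def[OF int_f] by simp
  moreover have "(\<integral>\<omega>. f \<omega> \<partial>Q) = b * (1 - measure Q (A N)) - l * (\<Sum>t<N. measure Q (A t)) + 1"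
    unfolding f_def using T prob_space by (simp add: less_top[symmetric] space_Q[symmetric] Int_absorb2 sets.sets_into_space)
  ultimately show ?thesis
    unfolding A_def b_def by linarith
qed

lemma regret_log_wealth:
  assumes W: "e_process S W" and regret: "portfolio_regret_bound S W r"
    and \<omega>: "\<omega> \<in> space (path_space S)" "\<forall>i\<ge>1. 0 < lam \<bullet> evec i \<omega>" and n: "1 \<le> n"
  shows "0 < W n \<omega>" "(\<Sum>i\<in>{1..n}. ln (lam \<bullet> evec i \<omega>)) - r n \<le> ln (W n \<omega>)"
proof -
  have "ereal (\<Sum>i\<in>{1..n}. ln (lam \<bullet> evec i \<omega>)) = (\<Sum>i=1..n. elog (lam \<bullet> evec i \<omega>))"
    unfolding sum_ereal[symmetric] using \<omega>(2) by (intro sum.cong) (auto simp: elog_def)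
  also have "\<dots> \<le> (SUP lam\<in>weight_simplex. \<Sum>i=1..n. elog (lam \<bullet> evec i \<omega>))"
    by (rule SUP_upper[OF lam_simplex])
  also have "\<dots> \<le> elog (W n \<omega>) + ereal (r n)"
    using regret \<omega>(1) n unfolding portfolio_regret_bound_def by blast
  finally have le: "ereal (\<Sum>i\<in>{1..n}. ln (lam \<bullet> evec i \<omega>)) \<le> elog (W n \<omega>) + ereal (r n)" .
  have "0 \<le> W n \<omega>"
    using W \<omega>(1) n by (simp add: e_process_def nonneg_adapted_def)
  moreover have "W n \<omega> \<noteq> 0"
    using le by (auto simp: elog_def)
  ultimately show "0 < W n \<omega>"
    by simp
  with le show "(\<Sum>i\<in>{1..n}. ln (lam \<bullet> evec i \<omega>)) - r n \<le> ln (W n \<omega>)"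
    by (simp add: elog_def)
qed

lemma truncated_growth:
  assumes "v < l"
  obtains c where "0 \<le> c" "v < (\<integral>\<omega>. min (ln (lam \<bullet> evec 1 \<omega>)) c \<partial>Q)"
proof -
  have [measurable]: "(\<lambda>\<omega>. lam \<bullet> evec 1 \<omega>) \<in> borel_measurable Q"
    by (rule measurable_wealth) simp
  have "(\<lambda>n. \<integral>\<omega>. min (ln (lam \<bullet> evec 1 \<omega>)) (real n) \<partial>Q) \<longlonglongrightarrow> (\<integral>\<omega>. ln (lam \<bullet> evec 1 \<omega>) \<partial>Q)"
  proof (rule integral_dominated_convergence[where w = "\<lambda>\<omega>. \<bar>ln (lam \<bullet> evec 1 \<omega>)\<bar>"])
    show "AE \<omega> in Q. (\<lambda>n. min (ln (lam \<bullet> evec 1 \<omega>)) (real n)) \<longlonglongrightarrow> ln (lam \<bullet> evec 1 \<omega>)"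
    proof (rule AE_I2)
      fix \<omega> :: "('d, 'b) path"
      have "\<forall>\<^sub>F n in sequentially. ln (lam \<bullet> evec 1 \<omega>) \<le> real n"
        using filterlim_real_sequentially by (simp add: filterlim_at_top)
      then have "\<forall>\<^sub>F n in sequentially. min (ln (lam \<bullet> evec 1 \<omega>)) (real n) = ln (lam \<bullet> evec 1 \<omega>)"
        by eventually_elim simp
      then show "(\<lambda>n. min (ln (lam \<bullet> evec 1 \<omega>)) (real n)) \<longlonglongrightarrow> ln (lam \<bullet> evec 1 \<omega>)"
        by (rule tendsto_eventually)
    qed
  qed (use integrable_log_wealth in auto)
  from order_tendstoD(1)[OF this] assms have "\<forall>\<^sub>F n in sequentially. v < (\<integral>\<omega>. min (ln (lam \<bullet> evec 1 \<omega>)) (real n) \<partial>Q)"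
    by (simp add: integral_log_wealth[unfolded One_nat_def])
  then obtain n where "v < (\<integral>\<omega>. min (ln (lam \<bullet> evec 1 \<omega>)) (real n) \<partial>Q)"
    by (auto simp: eventually_sequentially)
  then show ?thesis
    by (intro that[of "real n"]) auto
qed

text \<open>
  Before rejection the truncated walk, whose slope loss \<open>\<epsilon>\<close> pays for the linear part of the regret, is
  below \<open>ln (1 / \<alpha>) + C\<close>; the step at which rejection occurs adds at most \<open>c\<close>. Comparing with Wald's
  identity bounds the expected number of steps. The constant is the same for all levels \<open>\<alpha>\<close>.
\<close>

lemma expected_duration_upper_bound:
  assumes W: "e_process S W" and regret: "portfolio_regret_bound S W r"
    and sublinear: "r \<in> o(\<lambda>n. real n)" and v: "v < l"
  obtains K where "0 \<le> K" "\<And>\<alpha> N. 0 < \<alpha> \<Longrightarrow> \<alpha> < 1 \<Longrightarrow>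
    v * (\<Sum>t<N. measure Q (running S W \<alpha> t)) \<le> ln (1 / \<alpha>) + K"
proof -
  \<comment> \<open>Half of the gap \<open>l - v\<close> is spent on the regret, the other half on the truncation.\<close>
  define \<epsilon> where "\<epsilon> = (l - v) / 2"
  have \<epsilon>: "0 < \<epsilon>" "v + \<epsilon> < l"
    using v by (auto simp: \<epsilon>_def field_simps)
  obtain c where c: "0 \<le> c" "v + \<epsilon> < (\<integral>\<omega>. min (ln (lam \<bullet> evec 1 \<omega>)) c \<partial>Q)"
    by (rule truncated_growth[OF \<epsilon>(2)])
  obtain n0 where n0: "\<And>n. n0 \<le> n \<Longrightarrow> \<bar>r n\<bar> \<le> \<epsilon> * real n"
    using landau_o.smallD[OF sublinear \<epsilon>(1)] by (auto simp: eventually_sequentially)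
  \<comment> \<open>A bound for the finitely many regrets not covered by \<open>\<epsilon> n\<close>.\<close>
  define C where "C = (\<Sum>n<n0. \<bar>r n\<bar>)"
  have C: "0 \<le> C"
    by (simp add: C_def sum_nonneg)
  have r_le: "r n \<le> C + \<epsilon> * real n" for n
  proof (cases "n0 \<le> n")
    case True
    then show ?thesis using n0[of n] C by linarith
  next
    case False
    then have "\<bar>r n\<bar> \<le> C"
      unfolding C_def by (intro member_le_sum) auto
    moreover have "0 \<le> \<epsilon> * real n"
      using \<epsilon> by simp
    ultimately show ?thesis by linarith
  qed
  define Y where "Y x = min (ln (lam \<bullet> x)) c - \<epsilon>" for x :: "real^'d"
  have Y: "Y \<in> borel_measurable borel" "integrable Q (\<lambda>\<omega>. Y (evec 1 \<omega>))"
  proof -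
    show "Y \<in> borel_measurable borel"
      unfolding Y_def by measurable
    show "integrable Q (\<lambda>\<omega>. Y (evec 1 \<omega>))"
      unfolding Y_def using integrable_log_wealth by simp
  qed
  have "(\<integral>\<omega>. Y (evec 1 \<omega>) \<partial>Q) = (\<integral>\<omega>. min (ln (lam \<bullet> evec 1 \<omega>)) c \<partial>Q) - \<epsilon>"
    unfolding Y_def using integrable_log_wealth prob_space by (subst Bochner_Integration.integral_diff) auto
  then have mean: "v \<le> (\<integral>\<omega>. Y (evec 1 \<omega>) \<partial>Q)"
    using c by linarith
  have adapted: "nonneg_adapted S W"
    using W by (simp add: e_process_def)
  have "v * (\<Sum>t<N. measure Q (running S W \<alpha> t)) \<le> ln (1 / \<alpha>) + (C + c)" if \<alpha>: "0 < \<alpha>" "\<alpha> < 1" for \<alpha> N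
  proof -
    define A where "A = running S W \<alpha>"
    have A: "A t \<in> sets (obs_filtration S t)" "A (Suc t) \<subseteq> A t" for t
      unfolding A_def by (rule running_in_filtration[OF adapted], rule running_antimono, simp)
    have b: "0 < ln (1 / \<alpha>)"
      using \<alpha> by simp
    note wald = wald_identity_truncated[OF iid Y A(1), of N]
    have "AE \<omega> in Q. (\<Sum>t<N. indicator (A t) \<omega> * Y (evec (Suc t) \<omega>)) \<le> ln (1 / \<alpha>) + (C + c)"
      using wealth_pos AE_space
    proof eventually_elim
      case (elim \<omega>)
      obtain k where k: "\<And>t. t < k \<Longrightarrow> \<omega> \<in> A t"
        and sum: "\<And>y :: nat \<Rightarrow> real. (\<Sum>t<N. indicator (A t) \<omega> * y (Suc t)) = (\<Sum>i\<in>{1..k}. y i)"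
        using stopped_sum_eq[of A N \<omega>, OF A(2)] by metis
      have running_le: "(\<Sum>i\<in>{1..t}. Y (evec i \<omega>)) \<le> ln (1 / \<alpha>) + C" if "\<omega> \<in> A t" for t
      proof (cases "t = 0")
        case False
        have \<omega>: "\<omega> \<in> space (path_space S)"
          using elim(2) by (simp add: space_Q)
        have W_lt: "W t \<omega> < 1 / \<alpha>"
          using that False by (auto simp: A_def running_def)
        note W_ge = regret_log_wealth[OF W regret \<omega> elim(1), of t]
        have "(\<Sum>i\<in>{1..t}. Y (evec i \<omega>)) \<le> (\<Sum>i\<in>{1..t}. ln (lam \<bullet> evec i \<omega>) - \<epsilon>)"
          unfolding Y_def by (intro sum_mono) simp
        also have "\<dots> = (\<Sum>i\<in>{1..t}. ln (lam \<bullet> evec i \<omega>)) - \<epsilon> * real t"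
          by (simp add: sum_subtractf)
        also have "\<dots> \<le> ln (W t \<omega>) + C"
          using W_ge False r_le[of t] by simp
        also have "ln (W t \<omega>) \<le> ln (1 / \<alpha>)"
        proof (rule ln_mono)
          show "0 < W t \<omega>"
            using W_ge(1) False by simp
        qed (use W_lt in simp)
        finally show ?thesis by simp
      qed (use b C in simp)
      show ?case
      proof (cases k)
        case 0
        then show ?thesis using sum[of "\<lambda>i. Y (evec i \<omega>)"] b C c by simp
      next
        case (Suc j)
        have "(\<Sum>i\<in>{1..Suc j}. Y (evec i \<omega>)) = (\<Sum>i\<in>{1..j}. Y (evec i \<omega>)) + Y (evec (Suc j) \<omega>)"
          by simp
        also have "\<dots> \<le> (ln (1 / \<alpha>) + C) + c"
          using \<epsilon> k[of j] Suc by (intro add_mono running_le) (auto simp: Y_def)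
        finally show ?thesis
          using sum[of "\<lambda>i. Y (evec i \<omega>)"] Suc by simp
      qed
    qed
    then have "(\<integral>\<omega>. (\<Sum>t<N. indicator (A t) \<omega> * Y (evec (Suc t) \<omega>)) \<partial>Q) \<le> ln (1 / \<alpha>) + (C + c)"
      using wald(1) by (intro integral_le_const) auto
    moreover have "v * (\<Sum>t<N. measure Q (A t)) \<le> (\<integral>\<omega>. Y (evec 1 \<omega>) \<partial>Q) * (\<Sum>t<N. measure Q (A t))"
      using mean by (intro mult_right_mono) (auto simp: sum_nonneg)
    ultimately have "v * (\<Sum>t<N. measure Q (A t)) \<le> ln (1 / \<alpha>) + (C + c)"
      unfolding wald(2) by linarith
    then show ?thesis
      by (simp only: A_def)
  qed
  then show ?thesis
    using that[of "C + c"] C c by simp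
qed

end

section \<open>The asymptotics of the expected rejection time\<close>

theorem theorem3p3:
  fixes S :: "'b measure"
    and W :: "nat \<Rightarrow> ('d::finite, 'b) path \<Rightarrow> real"
    and r :: "nat \<Rightarrow> real"
    and Q :: "('d, 'b) path measure"
    and lamQ :: "real^'d"
    and l s :: real
  assumes e_proc: "e_process S W"
    and regret: "portfolio_regret_bound S W r"
    and sublinear: "r \<in> o(\<lambda>n. real n)"
    and alternative: "iid_dist S Q"
    and optimal: "log_optimal Q lamQ"
    and growth: "expected_log Q (\<lambda>\<omega>. lamQ \<bullet> evec 1 \<omega>) = ereal l"
    and pos: "l > 0"
    and s: "s > 2"
    and moment: "log_abs_moment Q s (\<lambda>\<omega>. lamQ \<bullet> evec 1 \<omega>) l < \<infinity>"
    and cash: "cash_superfluous Q lamQ"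
  shows "((\<lambda>\<alpha>. (\<integral>\<^sup>+ \<omega>. ennreal_of_enat (rejection_time W \<alpha> \<omega>) \<partial>Q) / ennreal (ln (1 / \<alpha>)))
           \<longlongrightarrow> ennreal (1 / l)) (at_right 0)"
proof -
  interpret log_optimal_portfolio S Q lamQ l
    using alternative optimal growth cash by unfold_locales
  define p where "p \<alpha> t = measure Q (running S W \<alpha> t)" for \<alpha> t
  define e where "e \<alpha> = (\<Sum>t. p \<alpha> t)" for \<alpha>
  have small: "\<forall>\<^sub>F \<alpha> in at_right (0::real). 0 < \<alpha> \<and> \<alpha> < 1"
    using eventually_at_right_less[of "0::real"] eventually_at_right_field[of _ "0::real"]
    by (auto simp: eventually_at_right_field intro!: exI[of _ 1])
  have p_nonneg: "0 \<le> p \<alpha> t" for \<alpha> t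
    by (simp add: p_def)
  have upper: "summable (p \<alpha>) \<and> e \<alpha> \<le> (ln (1 / \<alpha>) + K) / v"
    if K: "\<And>\<alpha> N. 0 < \<alpha> \<Longrightarrow> \<alpha> < 1 \<Longrightarrow> v * (\<Sum>t<N. p \<alpha> t) \<le> ln (1 / \<alpha>) + K"
      and "0 < v" "0 < \<alpha>" "\<alpha> < 1" for v K \<alpha>
  proof -
    have bound: "(\<Sum>t<N. p \<alpha> t) \<le> (ln (1 / \<alpha>) + K) / v" for N
      using K[of \<alpha> N] that(2-4) by (simp add: field_simps)
    then have sm: "summable (p \<alpha>)"
      by (intro summableI_nonneg_bounded p_nonneg)
    then show ?thesis
      unfolding e_def using bound by (auto intro: suminf_le_const)
  qed
  have ex_K: "\<exists>K. 0 \<le> K \<and> (\<forall>\<alpha> N. 0 < \<alpha> \<longrightarrow> \<alpha> < 1 \<longrightarrow> v * (\<Sum>t<N. p \<alpha> t) \<le> ln (1 / \<alpha>) + K)" if "v < l" for v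
    using expected_duration_upper_bound[OF e_proc regret sublinear that] unfolding p_def by metis
  have summ: "summable (p \<alpha>)" if "0 < \<alpha>" "\<alpha> < 1" for \<alpha>
  proof -
    obtain K where K: "\<And>\<alpha> N. 0 < \<alpha> \<Longrightarrow> \<alpha> < 1 \<Longrightarrow> l / 2 * (\<Sum>t<N. p \<alpha> t) \<le> ln (1 / \<alpha>) + K"
      using ex_K[of "l / 2"] pos by auto
    show ?thesis
      using upper[OF K _ that] pos by simp
  qed
  have lower: "ln (1 / \<alpha>) \<le> l * e \<alpha> + 1" if \<alpha>: "0 < \<alpha>" "\<alpha> < 1" for \<alpha>
  proof (rule LIMSEQ_le)
    have "p \<alpha> \<longlonglongrightarrow> 0"
      by (rule summable_LIMSEQ_zero[OF summ[OF \<alpha>]])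
    then show "(\<lambda>N. ln (1 / \<alpha>) * (1 - p \<alpha> N)) \<longlonglongrightarrow> ln (1 / \<alpha>)"
      by (auto intro!: tendsto_eq_intros)
    show "(\<lambda>N. l * (\<Sum>t<N. p \<alpha> t) + 1) \<longlonglongrightarrow> l * e \<alpha> + 1"
      unfolding e_def by (intro tendsto_intros summable_LIMSEQ summ[OF \<alpha>])
    show "\<exists>N. \<forall>n\<ge>N. ln (1 / \<alpha>) * (1 - p \<alpha> n) \<le> l * (\<Sum>t<n. p \<alpha> t) + 1"
      using expected_duration_lower_bound[OF e_proc \<alpha>(1)] unfolding p_def by blast
  qed
  have "((\<lambda>\<alpha>. e \<alpha> / ln (1 / \<alpha>)) \<longlongrightarrow> 1 / l) (at_right 0)"
  proof (rule order_tendstoI)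
    fix u assume u: "u < 1 / l"
    have "((\<lambda>\<alpha>. 1 - 1 / ln (1 / \<alpha>)) \<longlongrightarrow> 1) (at_right (0::real))"
      by real_asymp
    then have "((\<lambda>\<alpha>. (1 - 1 / ln (1 / \<alpha>)) / l) \<longlongrightarrow> 1 / l) (at_right 0)"
      using pos by (intro tendsto_divide tendsto_const) auto
    from order_tendstoD(1)[OF this u] small show "\<forall>\<^sub>F \<alpha> in at_right 0. u < e \<alpha> / ln (1 / \<alpha>)"
    proof eventually_elim
      case (elim \<alpha>)
      then have b: "0 < ln (1 / \<alpha>)" by simp
      note \<open>u < (1 - 1 / ln (1 / \<alpha>)) / l\<close>
      also have "(1 - 1 / ln (1 / \<alpha>)) / l = (ln (1 / \<alpha>) - 1) / l / ln (1 / \<alpha>)"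
        using b by (simp add: diff_divide_distrib)
      also have "\<dots> \<le> e \<alpha> / ln (1 / \<alpha>)"
        using lower[of \<alpha>] elim b pos by (intro divide_right_mono) (auto simp: field_simps)
      finally show ?case .
    qed
  next
    fix u assume u: "1 / l < u"
    \<comment> \<open>A mean increment \<open>v < l\<close> with \<open>1 / v < u\<close>.\<close>
    define v where "v = (1 / u + l) / 2"
    have u_pos: "0 < u"
      using u pos by (meson divide_pos_pos less_trans zero_less_one)
    then have "1 / u < l"
      using u pos by (simp add: field_simps)
    then have v: "0 < v" "v < l" "1 / u < v"
      using u_pos pos by (auto simp: v_def field_simps intro!: add_pos_pos)
    then have v_u: "1 / v < u"
      using u_pos by (simp add: field_simps)
    obtain K where K: "\<And>\<alpha> N. 0 < \<alpha> \<Longrightarrow> \<alpha> < 1 \<Longrightarrow> v * (\<Sum>t<N. p \<alpha> t) \<le> ln (1 / \<alpha>) + K"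
      using ex_K[OF v(2)] by auto
    have "((\<lambda>\<alpha>. 1 + K / ln (1 / \<alpha>)) \<longlongrightarrow> 1) (at_right (0::real))"
      by real_asymp
    then have "((\<lambda>\<alpha>. (1 + K / ln (1 / \<alpha>)) / v) \<longlongrightarrow> 1 / v) (at_right 0)"
      using v by (intro tendsto_divide tendsto_const) auto
    from order_tendstoD(2)[OF this v_u] small show "\<forall>\<^sub>F \<alpha> in at_right 0. e \<alpha> / ln (1 / \<alpha>) < u"
    proof eventually_elim
      case (elim \<alpha>)
      then have b: "0 < ln (1 / \<alpha>)" by simp
      have "e \<alpha> / ln (1 / \<alpha>) \<le> (ln (1 / \<alpha>) + K) / v / ln (1 / \<alpha>)"
        using upper[OF K v(1)] elim b by (intro divide_right_mono) auto
      also have "\<dots> = (1 + K / ln (1 / \<alpha>)) / v"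
        using b by (simp add: add_divide_distrib)
      finally show ?case
        using elim by linarith
    qed
  qed
  then have "((\<lambda>\<alpha>. ennreal (e \<alpha> / ln (1 / \<alpha>))) \<longlongrightarrow> ennreal (1 / l)) (at_right 0)"
    by (rule tendsto_ennrealI)
  moreover have "\<forall>\<^sub>F \<alpha> in at_right 0. ennreal (e \<alpha> / ln (1 / \<alpha>)) =
      (\<integral>\<^sup>+ \<omega>. ennreal_of_enat (rejection_time W \<alpha> \<omega>) \<partial>Q) / ennreal (ln (1 / \<alpha>))"
    using small
  proof eventually_elim
    case (elim \<alpha>)
    have "(\<integral>\<^sup>+ \<omega>. ennreal_of_enat (rejection_time W \<alpha> \<omega>) \<partial>Q) = (\<Sum>t. ennreal (p \<alpha> t))"
      using e_proc by (subst expected_rejection_time[OF _ sets_Q]) (auto simp: e_process_def p_def emeasure_eq_measure)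
    also have "\<dots> = ennreal (e \<alpha>)"
      unfolding e_def using summ elim p_nonneg by (intro suminf_ennreal2) auto
    finally show ?case
      using elim suminf_nonneg[OF summ p_nonneg] by (simp add: divide_ennreal e_def)
  qed
  ultimately show ?thesis
    by (rule Lim_transform_eventually)
qed

end
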